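(* Let $\mathcal{H}_A\otimes\mathcal{H}_B$ be a finite-dimensional bipartite Hilbert space. The $S^{t}$-entropy entanglement $E_t$ is an entanglement measure, i.e. it satisfies: (E1) $E_t(\rho)\ge0$ for every state $\rho$, with $E_t(\rho)=0$ if and only if $\rho$ is separable; (E2) $E_t\big((U_A\otimes U_B)\rho(U_A\otimes U_B)^\dagger\big)=E_t(\rho)$ for all local unitaries $U_A,U_B$; (E3) for every LOCC operation mapping $\rho$ to the ensemble $\{p_j,\sigma_j\}$ (i.e. outcome $j$ occurs with probability $p_j$ leaving state $\sigma_j$), $\sum_jp_jE_t(\sigma_j)\le E_t(\rho)$; (E4) $E_t(\sum_ip_i\rho_i)\le\sum_ip_iE_t(\rho_i)$ for every probability distribution $\{p_i\}$ and states $\rho_i$.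
   Context: For a density operator $\rho$ on a finite-dimensional Hilbert space, the total entropy is $S^{t}(\rho)=-\mathrm{Tr}\big[\rho\log_2\rho+(\mathbb{1}-\rho)\log_2(\mathbb{1}-\rho)\big]=\sum_i g(\lambda_i)$, where $\lambda_i$ are the eigenvalues of $\rho$ and $g(x)=-x\log_2x-(1-x)\log_2(1-x)$ (convention $0\log_20=0$). The $S^{t}$-entropy entanglement of a pure state $|\Phi\rangle_{AB}$ on $\mathcal{H}_A\otimes\mathcal{H}_B$ with $\dim\mathcal{H}_A=d$ is $E_t(|\Phi\rangle_{AB})=\frac1r S^{t}(\varrho_A)$ where $\varrho_A=\mathrm{Tr}_B|\Phi\rangle\langle\Phi|$ and $r=d\log_2d-(d-1)\log_2(d-1)$ is a fixed normalization constant. For a mixed state, $E_t(\rho_{AB})=\inf\sum_ip_iE_t(|\Phi_i\rangle)$, the infimum over all decompositions $\rho_{AB}=\sum_ip_i|\Phi_i\rangle\langle\Phi_i|$ into pure states with $p_i\ge0$, $\sum_ip_i=1$. *)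

theory Defs
  imports Complex_Main "HOL-Computational_Algebra.Polynomial"
    "Jordan_Normal_Form.Schur_Decomposition"
begin

text \<open>Finite-dimensional bipartite system: H_A = C^dA, H_B = C^dB, and
  H_A (x) H_B = C^(dA*dB) with basis index (i,k) mapped to i*dB + k.
  Operators are complex matrices.\<close>

definition msum :: "nat \<Rightarrow> nat \<Rightarrow> complex mat list \<Rightarrow> complex mat" where
  "msum r c Ms = mat r c (\<lambda>(a,b). sum_list (map (\<lambda>M. M $$ (a,b)) Ms))"

definition kron :: "complex mat \<Rightarrow> complex mat \<Rightarrow> complex mat" where
  "kron A B = mat (dim_row A * dim_row B) (dim_col A * dim_col B)
     (\<lambda>(i,j). A $$ (i div dim_row B, j div dim_col B) * B $$ (i mod dim_row B, j mod dim_col B))"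

definition trace :: "complex mat \<Rightarrow> complex" where
  "trace A = (\<Sum>i<dim_row A. A $$ (i,i))"

definition cinner :: "complex vec \<Rightarrow> complex vec \<Rightarrow> complex" where
  "cinner v w = (\<Sum>i<dim_vec v. cnj (v $ i) * w $ i)"

definition density_op :: "nat \<Rightarrow> complex mat \<Rightarrow> bool" where
  "density_op n \<rho> \<longleftrightarrow> \<rho> \<in> carrier_mat n n \<and> mat_adjoint \<rho> = \<rho> \<and>
     (\<forall>v \<in> carrier_vec n. 0 \<le> Re (cinner v (\<rho> *\<^sub>v v))) \<and> trace \<rho> = 1"

definition unitary :: "nat \<Rightarrow> complex mat \<Rightarrow> bool" where
  "unitary n U \<longleftrightarrow> U \<in> carrier_mat n n \<and> U * mat_adjoint U = 1\<^sub>m n"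

definition unit_vec :: "nat \<Rightarrow> complex vec \<Rightarrow> bool" where
  "unit_vec n v \<longleftrightarrow> v \<in> carrier_vec n \<and> cinner v v = 1"

definition proj :: "complex vec \<Rightarrow> complex mat" where
  "proj v = mat (dim_vec v) (dim_vec v) (\<lambda>(i,j). v $ i * cnj (v $ j))"

definition ptrace_B :: "nat \<Rightarrow> nat \<Rightarrow> complex mat \<Rightarrow> complex mat" where
  "ptrace_B dA dB \<rho> = mat dA dA (\<lambda>(i,j). \<Sum>k<dB. \<rho> $$ (i*dB + k, j*dB + k))"

definition eigvals :: "complex mat \<Rightarrow> complex multiset" where
  "eigvals \<rho> = proots (char_poly \<rho>)"

definition negxlog :: "real \<Rightarrow> real" where
  "negxlog x = (if x \<le> 0 then 0 else - x * log 2 x)"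

definition gfun :: "real \<Rightarrow> real" where
  "gfun x = negxlog x + negxlog (1 - x)"

definition total_entropy :: "complex mat \<Rightarrow> real" where
  "total_entropy \<rho> = sum_mset (image_mset (\<lambda>x. gfun (Re x)) (eigvals \<rho>))"

definition rnorm :: "nat \<Rightarrow> real" where
  "rnorm d = real d * log 2 (real d) - (real d - 1) * log 2 (real d - 1)"

definition Et_pure :: "nat \<Rightarrow> nat \<Rightarrow> complex vec \<Rightarrow> real" where
  "Et_pure dA dB \<phi> = total_entropy (ptrace_B dA dB (proj \<phi>)) / rnorm dA"

definition Et :: "nat \<Rightarrow> nat \<Rightarrow> complex mat \<Rightarrow> real" where
  "Et dA dB \<rho> = Inf {(\<Sum>i<n. p i * Et_pure dA dB (\<phi> i)) | n p \<phi>.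
      (\<forall>i<n. 0 \<le> p i \<and> unit_vec (dA*dB) (\<phi> i)) \<and> (\<Sum>i<n. p i) = 1 \<and>
      \<rho> = msum (dA*dB) (dA*dB) (map (\<lambda>i. of_real (p i) \<cdot>\<^sub>m proj (\<phi> i)) [0..<n])}"

definition separable :: "nat \<Rightarrow> nat \<Rightarrow> complex mat \<Rightarrow> bool" where
  "separable dA dB \<rho> \<longleftrightarrow> (\<exists>n p \<sigma>A \<sigma>B.
      (\<forall>i<n. 0 \<le> p i \<and> density_op dA (\<sigma>A i) \<and> density_op dB (\<sigma>B i)) \<and>
      (\<Sum>i<n. p i) = (1::real) \<and>
      \<rho> = msum (dA*dB) (dA*dB) (map (\<lambda>i. of_real (p i) \<cdot>\<^sub>m kron (\<sigma>A i) (\<sigma>B i)) [0..<n]))"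

definition kraus_apply :: "nat \<Rightarrow> complex mat list \<Rightarrow> complex mat \<Rightarrow> complex mat" where
  "kraus_apply n Ks \<rho> = msum n n (map (\<lambda>K. K * \<rho> * mat_adjoint K) Ks)"

text \<open>LOCC instruments (finitely many rounds, finitely many outcomes).
  locc a b a' b' Ms: an LOCC instrument from C^a (x) C^b to C^a' (x) C^b';
  outcome j acts on (unnormalised) operators as the map Ms ! j.
  Each round one party performs a local instrument (outcome j given by Kraus operators
  Ks j, which may change that party's local dimension), the outcome is communicated and
  the rest of the protocol depends on it.  Outcomes may be coarse-grained.\<close>
inductive locc :: "nat \<Rightarrow> nat \<Rightarrow> nat \<Rightarrow> nat \<Rightarrow> (complex mat \<Rightarrow> complex mat) list \<Rightarrow> bool" where
  locc_id: "locc a b a b [(\<lambda>\<rho>. \<rho>)]"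
| locc_A: "\<lbrakk> \<forall>j<m. \<forall>K \<in> set (Ks j). K \<in> carrier_mat (a' j) a;
     msum a a (concat (map (\<lambda>j. map (\<lambda>K. mat_adjoint K * K) (Ks j)) [0..<m])) = 1\<^sub>m a;
     \<forall>j<m. locc (a' j) b a'' b'' (L j) \<rbrakk> \<Longrightarrow>
   locc a b a'' b'' (concat (map (\<lambda>j. map (\<lambda>M. M \<circ> kraus_apply (a' j * b) (map (\<lambda>K. kron K (1\<^sub>m b)) (Ks j))) (L j)) [0..<m]))"
| locc_B: "\<lbrakk> \<forall>j<m. \<forall>K \<in> set (Ks j). K \<in> carrier_mat (b' j) b;
     msum b b (concat (map (\<lambda>j. map (\<lambda>K. mat_adjoint K * K) (Ks j)) [0..<m])) = 1\<^sub>m b;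
     \<forall>j<m. locc a (b' j) a'' b'' (L j) \<rbrakk> \<Longrightarrow>
   locc a b a'' b'' (concat (map (\<lambda>j. map (\<lambda>M. M \<circ> kraus_apply (a * b' j) (map (\<lambda>K. kron (1\<^sub>m a) K) (Ks j))) (L j)) [0..<m]))"
| locc_coarse: "\<lbrakk> locc a b a' b' Ms; \<forall>i<length Ms. f i < k \<rbrakk> \<Longrightarrow>
   locc a b a' b' (map (\<lambda>j \<rho>. msum (a'*b') (a'*b') (map (\<lambda>i. (Ms ! i) \<rho>) (filter (\<lambda>i. f i = j) [0..<length Ms]))) [0..<k])"

end

theory Submission
  imports Defs
begin

text \<open>
  Everything is reduced to finite lists of unnormalised vectors \<open>V\<close> with
  \<open>\<rho> = \<Sum>v\<leftarrow>V. |v><v|\<close>, whose cost is the sum of the entropies of the reduced operators, extended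
  homogeneously.  This homogeneous entropy is superadditive on positive operators: it
  increases when the spectrum is replaced by the diagonal in another orthonormal basis, and
  \<open>(x, t) \<mapsto> t g(x/t)\<close> is superadditive.

  A local operation of one party splits the reduced operator of the other party into a sum, and
  the two reduced operators of a pure state share their nonzero spectrum; hence by superadditivity
  no round of a protocol increases the cost, while coarse graining merely concatenates lists.

  For faithfulness, Caratheodory's theorem bounds the length of the lists, so that lists with cost
  tending to 0 have a limit point.  Since \<open>g(x) \<ge> x (1 - x)\<close>, the cost dominates the squared minors of
  order two of the coefficient matrices; these vanish in the limit, which therefore consists
  of product vectors.
\<close>

section \<open>The spectral theorem for Hermitian matrices\<close>

text \<open>Concavity of g compares states of trace 1, whereas the outcomes of a measurement carry
  probabilities. Extending the entropy homogeneously absorbs the probabilities and turns concavity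
  into superadditivity, which can be summed over Kraus operators, outcomes and rounds without
  renormalising. Because of the term 1 - x the contribution of an eigenvalue depends on the trace as
  well; hence t g(x/t) instead of a function of the eigenvalue alone.

  The factor 1/r depends on the dimension of A, which a protocol may change in between, so it is
  applied only at the two ends. For dim A = 1 it is 1/0, which is 0 here: E_t vanishes identically,
  and (E1) has to be argued separately.

  The infimum ranges over ensembles of unbounded length, which blocks a direct compactness argument.
  The Caratheodory reduction carries the cost along as one more coordinate and so preserves it
  exactly. In the limit only minors occur, which are polynomials in the coefficients.\<close>

lemma mat_adjoint_dim [simp]:
  "dim_row (mat_adjoint A) = dim_col A" "dim_col (mat_adjoint A) = dim_row A"
  by (auto simp: mat_adjoint_def)

lemma mat_adjoint_carrier [simp]: "A \<in> carrier_mat n m \<Longrightarrow> mat_adjoint A \<in> carrier_mat m n"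
  by (auto intro: carrier_matI)

lemma mult_carrier_mat_iff [simp]: "A * B \<in> carrier_mat n m \<longleftrightarrow> dim_row A = n \<and> dim_col B = m"
  by (metis carrier_matI carrier_matD index_mult_mat(2,3))

lemma mult_mat_vec_carrier_iff [simp]: "A *\<^sub>v v \<in> carrier_vec n \<longleftrightarrow> dim_row A = n"
  by (metis carrier_dim_vec dim_mult_mat_vec)

lemma mat_adjoint_index [simp]:
  "i < dim_col A \<Longrightarrow> j < dim_row A \<Longrightarrow> mat_adjoint A $$ (i,j) = cnj (A $$ (j,i))" for A :: "complex mat"
  by (simp add: mat_adjoint_def mat_of_rows_def)

lemma mat_adjoint_adjoint [simp]: "mat_adjoint (mat_adjoint A) = A" for A :: "complex mat"
  by (rule eq_matI) auto

lemma mat_adjoint_mult: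
  fixes A B :: "complex mat"
  assumes "A \<in> carrier_mat n m" "B \<in> carrier_mat m k"
  shows "mat_adjoint (A * B) = mat_adjoint B * mat_adjoint A"
  by (rule eq_matI) (use assms in \<open>auto simp: scalar_prod_def mult.commute intro!: sum.cong\<close>)

lemma mat_mult_index:
  "i < dim_row A \<Longrightarrow> j < dim_col B \<Longrightarrow> dim_row B = dim_col A \<Longrightarrow>
    (A * B) $$ (i,j) = (\<Sum>k<dim_col A. A $$ (i,k) * B $$ (k,j))"
  by (auto simp: scalar_prod_def lessThan_atLeast0 intro!: sum.cong)

lemma trace_mult_comm:
  assumes "A \<in> carrier_mat n m" "B \<in> carrier_mat m n"
  shows "trace (A * B) = trace (B * A)"
proof -
  have "trace (A * B) = (\<Sum>i<n. \<Sum>k<m. A $$ (i,k) * B $$ (k,i))"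
    using assms by (auto simp: trace_def mat_mult_index simp del: index_mult_mat(1) intro!: sum.cong)
  also have "\<dots> = (\<Sum>k<m. \<Sum>i<n. A $$ (i,k) * B $$ (k,i))" by (rule sum.swap)
  also have "\<dots> = trace (B * A)"
    using assms by (auto simp: trace_def mat_mult_index mult.commute simp del: index_mult_mat(1) intro!: sum.cong)
  finally show ?thesis .
qed

lemma trace_smult: "A \<in> carrier_mat n n \<Longrightarrow> trace (c \<cdot>\<^sub>m A) = c * trace A"
  by (auto simp: trace_def sum_distrib_left)

lemma trace_add: "A \<in> carrier_mat n n \<Longrightarrow> B \<in> carrier_mat n n \<Longrightarrow> trace (A + B) = trace A + trace B"
  by (auto simp: trace_def sum.distrib)

lemma unitaryD:
  assumes "unitary n U"
  shows "U \<in> carrier_mat n n" "U * mat_adjoint U = 1\<^sub>m n" "mat_adjoint U * U = 1\<^sub>m n"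
  using assms mat_mult_left_right_inverse[of U n "mat_adjoint U"] by (auto simp: unitary_def)

lemma unitary_mult:
  assumes "unitary n U" "unitary n V"
  shows "unitary n (U * V)"
proof -
  note U = unitaryD[OF assms(1)] and V = unitaryD[OF assms(2)]
  have "U * V * mat_adjoint (U * V) = U * (V * mat_adjoint V) * mat_adjoint U"
    using U(1) V(1) by (simp add: mat_adjoint_mult[OF U(1) V(1)] assoc_mult_mat[of _ n n _ n _ n])
  then show ?thesis using U V by (simp add: unitary_def)
qed

definition dmat :: "nat \<Rightarrow> (nat \<Rightarrow> real) \<Rightarrow> complex mat" where
  "dmat n d = mat n n (\<lambda>(i,j). if i = j then of_real (d i) else 0)"

lemma dmat_carrier [simp]: "dmat n d \<in> carrier_mat n n" by (simp add: dmat_def)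

lemma dmat_dim [simp]: "dim_row (dmat n d) = n" "dim_col (dmat n d) = n" by (simp_all add: dmat_def)

text \<open>Gram-Schmidt applied to a basis that starts with \<open>v\<close> keeps \<open>v\<close>
  in front and yields orthogonal vectors; dividing each by its norm \<open>s j\<close> gives the
  columns of a unitary matrix. This normalisation is why the first column is only a multiple of
  \<open>v\<close>.\<close>

lemma exists_unitary_first_col:
  fixes v :: "complex vec"
  assumes v: "v \<in> carrier_vec n" and v0: "v \<noteq> 0\<^sub>v n"
  shows "\<exists>W c. unitary n W \<and> col W 0 = c \<cdot>\<^sub>v v"
proof -
  interpret cof_vec_space n "TYPE(complex)" .
  define b where "b = basis_completion v"
  from basis_completion[OF v v0, folded b_def]
  have dist_b: "distinct b" and indep: "\<not> lin_dep (set b)" and b: "set b \<subseteq> carrier_vec n"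
    and hdb: "hd b = v" and len_b: "length b = n" by auto
  have n: "n \<noteq> 0" proof
    assume "n = 0"
    then have "v = 0\<^sub>v n" using v by (intro eq_vecI) auto
    then show False using v0 by simp
  qed
  with len_b hdb obtain vs where bv: "b = v # vs" by (cases b) auto
  define ws where "ws = gram_schmidt n b"
  from gram_schmidt_result[OF b dist_b indep refl, folded ws_def]
  have ws: "set ws \<subseteq> carrier_vec n" "corthogonal ws" "length ws = n" by (auto simp: len_b)
  have hdws: "hd ws = v" using gram_schmidt_hd[OF v, of vs, folded bv] by (simp add: ws_def)
  have wsc: "ws ! j \<in> carrier_vec n" if "j < n" for j using ws that by auto
  define s where "s j = sqrt (\<Sum>i<n. (cmod (ws ! j $ i))^2)" for j
  have ip: "(\<Sum>i<n. cnj (ws ! j $ i) * ws ! k $ i) = (if j = k then of_real ((s j)^2) else 0)"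
    if jk: "j < n" "k < n" for j k
  proof -
    have "ws ! k \<bullet>c ws ! j = (\<Sum>i<n. cnj (ws ! j $ i) * ws ! k $ i)"
      using wsc[OF jk(1)] wsc[OF jk(2)] by (auto simp: scalar_prod_def lessThan_atLeast0 intro!: sum.cong)
    moreover have "j \<noteq> k \<Longrightarrow> ws ! k \<bullet>c ws ! j = 0"
      using corthogonalD[OF ws(2), of k j] jk ws(3) by auto
    moreover have "(\<Sum>i<n. cnj (ws ! j $ i) * ws ! j $ i) = of_real ((s j)^2)"
      proof -
      have "cnj (ws ! j $ i) * ws ! j $ i = of_real ((cmod (ws ! j $ i))^2)" for i
        by (subst complex_norm_square) (rule mult.commute)
      then show ?thesis by (simp add: s_def sum_nonneg del: of_real_power)
    qed
    ultimately show ?thesis by auto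
  qed
  have s0: "s j \<noteq> 0" if j: "j < n" for j
  proof -
    have "ws ! j \<bullet>c ws ! j \<noteq> 0" using corthogonalD[OF ws(2), of j j] j ws(3) by auto
    also have "ws ! j \<bullet>c ws ! j = (\<Sum>i<n. cnj (ws ! j $ i) * ws ! j $ i)"
      using wsc[OF j] by (auto simp: scalar_prod_def lessThan_atLeast0 intro!: sum.cong)
    finally show ?thesis using ip[OF j j] by auto
  qed
  define W where "W = mat n n (\<lambda>(i,j). ws ! j $ i / of_real (s j))"
  have W: "W \<in> carrier_mat n n" by (simp add: W_def)
  have "mat_adjoint W * W = 1\<^sub>m n"
  proof (rule eq_matI)
    fix j k assume "j < dim_row (1\<^sub>m n)" "k < dim_col (1\<^sub>m n)"
    then have jk: "j < n" "k < n" by auto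
    have "(mat_adjoint W * W) $$ (j,k) = (\<Sum>i<n. cnj (ws ! j $ i) * ws ! k $ i) / of_real (s j * s k)"
      using jk by (auto simp: mat_mult_index W_def sum_divide_distrib simp del: index_mult_mat(1) intro!: sum.cong)
    then show "(mat_adjoint W * W) $$ (j,k) = 1\<^sub>m n $$ (j,k)"
      using jk s0 by (auto simp: ip power2_eq_square)
  qed (auto simp: W_def)
  then have "unitary n W"
    using mat_mult_left_right_inverse[of "mat_adjoint W" n W] W by (auto simp: unitary_def)
  moreover have "col W 0 = (1 / of_real (s 0)) \<cdot>\<^sub>v v"
    proof -
    have "ws ! 0 = v" using n hdws ws(3) hd_conv_nth[of ws] by fastforce
    then show ?thesis using n v by (intro eq_vecI) (auto simp: W_def)
  qed
  ultimately show ?thesis by blast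
qed

lemma hermitian_index: "mat_adjoint R = R \<Longrightarrow> i < dim_row R \<Longrightarrow> j < dim_row R \<Longrightarrow> R $$ (i,j) = cnj (R $$ (j,i))"
  for R :: "complex mat"
  by (metis mat_adjoint_dim(2) mat_adjoint_index)

text \<open>Deflation: conjugation by a unitary whose first column is an eigenvector turns
  \<open>R\<close> into the block sum of the eigenvalue and a smaller Hermitian matrix
  \<open>R'\<close>, to which the induction hypothesis applies.\<close>

theorem hermitian_spectral:
  fixes R :: "complex mat"
  assumes "R \<in> carrier_mat n n" "mat_adjoint R = R"
  shows "\<exists>U d. unitary n U \<and> R = U * dmat n d * mat_adjoint U"
  using assms
proof (induction n arbitrary: R)
  case 0
  then show ?case by (intro exI[of _ "1\<^sub>m 0"]) (auto simp: unitary_def intro!: eq_matI)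
next
  case (Suc n R)
  note R = Suc.prems
  obtain as where "char_poly R = (\<Prod>a\<leftarrow>as. [:- a, 1:])" "length as = Suc n"
    using char_poly_factorized[OF R(1)] by blast
  then obtain e where "poly (char_poly R) e = 0" by (cases as) auto
  then obtain v where v: "v \<in> carrier_vec (Suc n)" "v \<noteq> 0\<^sub>v (Suc n)" "R *\<^sub>v v = e \<cdot>\<^sub>v v"
    using eigenvalue_root_char_poly[OF R(1)] R(1) by (auto simp: eigenvalue_def eigenvector_def)
  obtain W c where W: "unitary (Suc n) W" and col: "col W 0 = c \<cdot>\<^sub>v v"
    using exists_unitary_first_col[OF v(1,2)] by blast
  note W' = unitaryD[OF W]
  define A where "A = mat_adjoint W * R * W"
  have A: "A \<in> carrier_mat (Suc n) (Suc n)" using W' R by (simp add: A_def)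
  have herm: "mat_adjoint A = A"
    using W' R by (simp add: A_def mat_adjoint_mult[of _ "Suc n" "Suc n" _ "Suc n"]
        assoc_mult_mat[of _ "Suc n" "Suc n" _ "Suc n" _ "Suc n"])
  have A0: "A $$ (i,0) = (if i = 0 then e else 0)" if i: "i < Suc n" for i
  proof -
    have "A $$ (i,0) = (mat_adjoint W * (R * W)) $$ (i,0)"
      using W' R by (simp add: A_def assoc_mult_mat[of _ "Suc n" "Suc n" _ "Suc n" _ "Suc n"])
    also have "\<dots> = row (mat_adjoint W) i \<bullet> col (R * W) 0"
      using i W'(1) R by simp
    also have "col (R * W) 0 = R *\<^sub>v col W 0" using col_mult2 R W' by blast
    also have "\<dots> = e \<cdot>\<^sub>v col W 0"
      using v R by (simp add: col mult_mat_vec[of R "Suc n" "Suc n"] smult_smult_assoc mult.commute)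
    also have "row (mat_adjoint W) i \<bullet> (e \<cdot>\<^sub>v col W 0) = e * (row (mat_adjoint W) i \<bullet> col W 0)"
      using W'(1) i by (intro scalar_prod_smult_distrib[of _ "Suc n"]) (auto intro!: carrier_vecI)
    also have "row (mat_adjoint W) i \<bullet> col W 0 = (mat_adjoint W * W) $$ (i,0)"
      using W'(1) i by simp
    finally show ?thesis using W'(3) i by simp
  qed
  \<comment> \<open>Hermitian symmetry carries the zeros of the first column over to the first row;
    comparing the corner entry in both shows that the eigenvalue is real.\<close>
  have A0': "A $$ (0,i) = (if i = 0 then cnj e else 0)" if i: "i < Suc n" for i
    using hermitian_index[OF herm, of 0 i] A A0 i by auto
  have e: "cnj e = e" using A0[of 0] A0'[of 0] by simp
  define R' where "R' = mat n n (\<lambda>(i,j). A $$ (Suc i, Suc j))"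
  have "mat_adjoint R' = R'"
  proof (rule eq_matI)
    fix i j assume "i < dim_row R'" "j < dim_col R'"
    then show "mat_adjoint R' $$ (i,j) = R' $$ (i,j)"
      using hermitian_index[OF herm, of "Suc i" "Suc j"] A by (simp add: R'_def)
  qed (auto simp: R'_def)
  then obtain U d where U: "unitary n U" and R'U: "R' = U * dmat n d * mat_adjoint U"
    using Suc.IH[of R'] by (auto simp: R'_def)
  note U' = unitaryD[OF U]
  define V where "V = four_block_mat (1\<^sub>m 1) (0\<^sub>m 1 n) (0\<^sub>m n 1) U"
  have V: "V \<in> carrier_mat (Suc n) (Suc n)" using U'(1) by (auto simp: V_def)
  have Vadj: "mat_adjoint V = four_block_mat (1\<^sub>m 1) (0\<^sub>m 1 n) (0\<^sub>m n 1) (mat_adjoint U)"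
    by (rule eq_matI) (use U'(1) in \<open>auto simp: V_def\<close>)
  have "V * mat_adjoint V = four_block_mat (1\<^sub>m 1) (0\<^sub>m 1 n) (0\<^sub>m n 1) (1\<^sub>m n)"
    unfolding Vadj using U' unfolding V_def
    by (subst mult_four_block_mat[of _ 1 1 _ n _ n]) auto
  also have "\<dots> = 1\<^sub>m (Suc n)" by (rule eq_matI) auto
  finally have VU: "unitary (Suc n) V" using V by (simp add: unitary_def)
  define d' where "d' = case_nat (Re e) d"
  have D: "dmat (Suc n) d' = four_block_mat (mat 1 1 (\<lambda>_. e)) (0\<^sub>m 1 n) (0\<^sub>m n 1) (dmat n d)"
    by (rule eq_matI) (use e in \<open>auto simp: dmat_def d'_def complex_eq_iff split: nat.splits\<close>)
  have "V * dmat (Suc n) d' * mat_adjoint V =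
      four_block_mat (mat 1 1 (\<lambda>_. e)) (0\<^sub>m 1 n) (0\<^sub>m n 1) (U * dmat n d) * mat_adjoint V"
    unfolding D using U' unfolding V_def
    by (subst mult_four_block_mat[of _ 1 1 _ n _ n]) auto
  also have "\<dots> = four_block_mat (mat 1 1 (\<lambda>_. e)) (0\<^sub>m 1 n) (0\<^sub>m n 1) R'"
    unfolding R'U Vadj using U' mult_carrier_mat[OF U'(1) dmat_carrier]
    by (subst mult_four_block_mat[of _ 1 1 _ n _ n]) auto
  also have "\<dots> = A"
  proof (rule eq_matI)
    fix i j assume "i < dim_row A" "j < dim_col A"
    then have "i < Suc n" "j < Suc n" using A by auto
    then show "four_block_mat (mat 1 1 (\<lambda>_. e)) (0\<^sub>m 1 n) (0\<^sub>m n 1) R' $$ (i, j) = A $$ (i,j)"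
      by (cases i; cases j) (auto simp: R'_def A0 A0' e)
  qed (use A in \<open>auto simp: R'_def\<close>)
  finally have AV: "A = V * dmat (Suc n) d' * mat_adjoint V" ..
  have "R = (W * mat_adjoint W) * R * (W * mat_adjoint W)" using W' R by simp
  also have "\<dots> = W * A * mat_adjoint W"
    using W'(1) R by (simp add: A_def assoc_mult_mat[of _ "Suc n" "Suc n" _ "Suc n" _ "Suc n"])
  also have "\<dots> = (W * V) * dmat (Suc n) d' * mat_adjoint (W * V)"
    using W' R V by (simp add: AV mat_adjoint_mult[OF W'(1) V] assoc_mult_mat[of _ "Suc n" "Suc n" _ "Suc n" _ "Suc n"])
  finally show ?case using unitary_mult[OF W VU] by blast
qed

section \<open>The total entropy as a spectral function\<close>

text \<open>Concavity: the right side is the tangent at \<open>y\<close>, and the inequality is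
  \<open>ln u \<le> u - 1\<close> at \<open>u = y / x\<close>.\<close>

lemma negxlog_tangent:
  assumes "0 \<le> x" "0 < y"
  shows "negxlog x \<le> - x * log 2 y + (y - x) / ln 2"
proof (cases "x = 0")
  case False
  with assms have x: "x > 0" by simp
  have "ln (y / x) \<le> y / x - 1" using x assms by (intro ln_le_minus_one) simp
  then have "x * (ln y - ln x) \<le> x * (y / x - 1)"
    using x assms by (intro mult_left_mono) (auto simp: ln_div)
  then have "- x * ln x \<le> - x * ln y + (y - x)" using x by (simp add: algebra_simps)
  then have "(- x * ln x) / ln 2 \<le> (- x * ln y + (y - x)) / ln 2"
    by (intro divide_right_mono) auto
  then show ?thesis using x by (simp add: negxlog_def log_def add_divide_distrib diff_divide_distrib)
qed (use assms in \<open>simp add: negxlog_def\<close>)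

text \<open>Averaging the tangent bound at the mean \<open>y\<close> leaves exactly
  \<open>negxlog y\<close>. At \<open>y = 0\<close> there is no tangent, but then each index has
  weight 0 or point 0.\<close>

lemma negxlog_jensen:
  fixes w x :: "'a \<Rightarrow> real"
  assumes fin: "finite I" and w: "\<And>i. i \<in> I \<Longrightarrow> 0 \<le> w i" "sum w I = 1"
    and x: "\<And>i. i \<in> I \<Longrightarrow> 0 \<le> x i"
  shows "(\<Sum>i\<in>I. w i * negxlog (x i)) \<le> negxlog (\<Sum>i\<in>I. w i * x i)"
proof -
  define y where "y = (\<Sum>i\<in>I. w i * x i)"
  have y0: "y \<ge> 0" using w x by (auto simp: y_def intro!: sum_nonneg)
  show ?thesis
  proof (cases "y = 0")
    case True
    then have "w i * x i = 0" if "i \<in> I" for i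
      using sum_nonneg_eq_0_iff[OF fin, of "\<lambda>i. w i * x i"] w x that by (auto simp: y_def)
    then have "(\<Sum>i\<in>I. w i * negxlog (x i)) = 0"
      by (intro sum.neutral ballI) (metis mult_eq_0_iff negxlog_def order.refl)
    then show ?thesis using True by (simp add: y_def[symmetric] negxlog_def)
  next
    case False
    with y0 have y: "y > 0" by simp
    have "(\<Sum>i\<in>I. w i * negxlog (x i)) \<le> (\<Sum>i\<in>I. w i * (- x i * log 2 y + (y - x i) / ln 2))"
      using w x y by (intro sum_mono mult_left_mono negxlog_tangent) auto
    also have "\<dots> = (\<Sum>i\<in>I. (w i * x i) * (- log 2 y - 1 / ln 2) + w i * (y / ln 2))"
      by (intro sum.cong) (auto simp: algebra_simps diff_divide_distrib)
    also have "\<dots> = y * (- log 2 y - 1 / ln 2) + sum w I * (y / ln 2)"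
      by (simp only: sum.distrib sum_distrib_right[symmetric] y_def[symmetric])
    also have "\<dots> = negxlog y" using y w by (simp add: negxlog_def algebra_simps)
    finally show ?thesis by (simp add: y_def)
  qed
qed

lemma gfun_jensen:
  fixes w x :: "'a \<Rightarrow> real"
  assumes fin: "finite I" and w: "\<And>i. i \<in> I \<Longrightarrow> 0 \<le> w i" "sum w I = 1"
    and x: "\<And>i. i \<in> I \<Longrightarrow> 0 \<le> x i" "\<And>i. i \<in> I \<Longrightarrow> x i \<le> 1"
  shows "(\<Sum>i\<in>I. w i * gfun (x i)) \<le> gfun (\<Sum>i\<in>I. w i * x i)"
proof -
  have "(\<Sum>i\<in>I. w i * (1 - x i)) = 1 - (\<Sum>i\<in>I. w i * x i)"
    using w by (simp add: algebra_simps sum_subtractf)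
  then show ?thesis
    using negxlog_jensen[OF fin w, of x] negxlog_jensen[OF fin w, of "\<lambda>i. 1 - x i"] x
    by (simp add: gfun_def distrib_left sum.distrib)
qed

lemma gfun_0 [simp]: "gfun 0 = 0" and gfun_1 [simp]: "gfun 1 = 0"
  by (simp_all add: gfun_def negxlog_def)

text \<open>Follows from \<open>- ln x \<ge> 1 - x\<close> and \<open>ln 2 \<le> 1\<close>. The
  quadratic on the left, summed over a spectrum, becomes a polynomial in the matrix entries.\<close>

lemma negxlog_lower:
  assumes "0 \<le> x" "x \<le> 1"
  shows "x * (1 - x) \<le> negxlog x"
proof (cases "x = 0")
  case False
  with assms have x: "x > 0" by simp
  have ln2: "0 < ln (2::real)" "ln (2::real) \<le> 1" using ln_le_minus_one[of 2] by auto
  have "x * (1 - x) * ln 2 \<le> x * (1 - x)" using assms ln2 by (intro mult_left_le) auto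
  also have "\<dots> \<le> x * (- ln x)"
    using ln_le_minus_one[OF x] x by (intro mult_left_mono) auto
  finally show ?thesis using ln2 x by (simp add: negxlog_def log_def field_simps)
qed (simp add: negxlog_def)

lemma gfun_lower:
  assumes "0 \<le> x" "x \<le> 1"
  shows "x * (1 - x) \<le> gfun x"
proof -
  have "0 \<le> (1 - x) * (1 - (1 - x))" using assms by simp
  also have "\<dots> \<le> negxlog (1 - x)" by (rule negxlog_lower) (use assms in auto)
  finally show ?thesis using negxlog_lower[OF assms] by (simp add: gfun_def)
qed

lemma gfun_nonneg: "0 \<le> x \<Longrightarrow> x \<le> 1 \<Longrightarrow> 0 \<le> gfun x"
  by (rule order_trans[OF _ gfun_lower]) auto

text \<open>\<open>eigvals\<close> is the root multiset of the characteristic polynomial, so any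
  splitting into linear factors determines it with multiplicities.\<close>

lemma total_entropy_char_poly:
  assumes "char_poly A = (\<Prod>a\<leftarrow>as. [:- a, 1:])"
  shows "total_entropy A = (\<Sum>a\<leftarrow>as. gfun (Re a))"
proof -
  have "proots (\<Prod>a\<leftarrow>as. [:- a, 1:]) = mset as" for as :: "complex list"
  proof (induction as)
    case (Cons a as)
    have "(\<Prod>a\<leftarrow>as. [:- a, 1:]) \<noteq> 0" by (auto simp: prod_list_zero_iff)
    then show ?case using Cons by (simp add: proots_mult del: mult_pCons_left)
  qed simp
  then have "eigvals A = mset as" by (simp add: eigvals_def assms)
  then show ?thesis by (simp add: total_entropy_def sum_mset_sum_list[symmetric])
qed

lemma total_entropy_unitary_diag:
  assumes "unitary n U"
  shows "total_entropy (U * dmat n d * mat_adjoint U) = (\<Sum>i<n. gfun (d i))"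
proof -
  note U = unitaryD[OF assms]
  have "similar_mat_wit (U * dmat n d * mat_adjoint U) (dmat n d) U (mat_adjoint U)"
    by (rule similar_mat_witI[of _ _ n]) (use U in auto)
  then have "char_poly (U * dmat n d * mat_adjoint U) = char_poly (dmat n d)"
    by (intro char_poly_similar) (auto simp: similar_mat_def)
  also have "\<dots> = (\<Prod>a\<leftarrow>diag_mat (dmat n d). [:- a, 1:])"
    by (intro char_poly_upper_triangular[of _ n]) (auto simp: dmat_def)
  finally have "total_entropy (U * dmat n d * mat_adjoint U) = (\<Sum>a\<leftarrow>diag_mat (dmat n d). gfun (Re a))"
    by (rule total_entropy_char_poly)
  also have "diag_mat (dmat n d) = map (\<lambda>i. complex_of_real (d i)) [0..<n]"
    by (simp add: diag_mat_def dmat_def)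
  also have "(\<Sum>a\<leftarrow>map (\<lambda>i. complex_of_real (d i)) [0..<n]. gfun (Re a)) = (\<Sum>i<n. gfun (d i))"
    by (simp add: o_def interv_sum_list_conv_sum_set_nat lessThan_atLeast0)
  finally show ?thesis .
qed

text \<open>The block matrix \<open>M\<close> with rows (X, A) and (B, 1) is made block triangular
  in two ways, by \<open>R\<close> from the right and by \<open>L\<close> from the left; both
  compute its determinant. The powers of X balance the sizes \<open>n\<close> and \<open>m\<close>
  whichever is larger.\<close>

lemma char_poly_mult_swap:
  fixes A B :: "complex mat"
  assumes A: "A \<in> carrier_mat n m" and B: "B \<in> carrier_mat m n"
  shows "[:0, 1:] ^ m * char_poly (A * B) = [:0, 1:] ^ n * char_poly (B * A)"
proof -
  define X :: "complex poly" where "X = [:0, 1:]"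
  define A' where "A' = map_mat (\<lambda>a. [:a:]) A"
  define B' where "B' = map_mat (\<lambda>a. [:a:]) B"
  have A': "A' \<in> carrier_mat n m" and B': "B' \<in> carrier_mat m n"
    using A B by (auto simp: A'_def B'_def)
  define M where "M = four_block_mat (X \<cdot>\<^sub>m 1\<^sub>m n) A' B' (1\<^sub>m m)"
  define L where "L = four_block_mat (1\<^sub>m n) (0\<^sub>m n m) (- B') (X \<cdot>\<^sub>m 1\<^sub>m m)"
  define R where "R = four_block_mat (1\<^sub>m n) (0\<^sub>m n m) (- B') (1\<^sub>m m)"
  have cM: "M \<in> carrier_mat (n+m) (n+m)" and cL: "L \<in> carrier_mat (n+m) (n+m)"
    and cR: "R \<in> carrier_mat (n+m) (n+m)"
    using A' B' by (auto simp: M_def L_def R_def)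
  have cpAB: "char_poly (A * B) = det (X \<cdot>\<^sub>m 1\<^sub>m n - A' * B')"
  proof -
    have "char_poly_matrix (A * B) = X \<cdot>\<^sub>m 1\<^sub>m n - map_mat (\<lambda>a. [:a:]) (A * B)"
      by (rule eq_matI) (use A B in \<open>auto simp: char_poly_matrix_def X_def\<close>)
    then show ?thesis by (simp add: char_poly_def map_poly_mult(1)[OF A B] A'_def B'_def)
  qed
  have cpBA: "char_poly (B * A) = det (X \<cdot>\<^sub>m 1\<^sub>m m - B' * A')"
  proof -
    have "char_poly_matrix (B * A) = X \<cdot>\<^sub>m 1\<^sub>m m - map_mat (\<lambda>a. [:a:]) (B * A)"
      by (rule eq_matI) (use A B in \<open>auto simp: char_poly_matrix_def X_def\<close>)
    then show ?thesis by (simp add: char_poly_def map_poly_mult(1)[OF B A] A'_def B'_def)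
  qed
  have MR: "M * R = four_block_mat (X \<cdot>\<^sub>m 1\<^sub>m n - A' * B') A' (0\<^sub>m m n) (1\<^sub>m m)"
    unfolding M_def R_def
    by (subst mult_four_block_mat[of _ n n _ m _ m _ _ n _ m])
       (use A' B' in \<open>auto intro!: cong_four_block_mat simp: minus_add_uminus_mat[symmetric]
          add_uminus_minus_mat[of _ n n] uminus_l_inv_mat\<close>)
  have LM: "L * M = four_block_mat (X \<cdot>\<^sub>m 1\<^sub>m n) A' (0\<^sub>m m n) (X \<cdot>\<^sub>m 1\<^sub>m m - B' * A')"
    unfolding M_def L_def
    by (subst mult_four_block_mat[of _ n n _ m _ m _ _ n _ m])
       (use A' B' in \<open>auto intro!: cong_four_block_mat\<close>)
  have dX: "det (X \<cdot>\<^sub>m 1\<^sub>m k) = X ^ k" for k by (simp add: det_smult)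
  have "det R = 1" unfolding R_def
    by (subst det_four_block_mat_upper_right_zero[of _ n _ m]) (use B' in auto)
  then have "det M = char_poly (A * B)"
    using det_mult[OF cM cR] A' B' unfolding MR cpAB
    by (subst (asm) det_four_block_mat_lower_left_zero[of _ n _ m]) auto
  moreover have "det L = X ^ m" unfolding L_def
    by (subst det_four_block_mat_upper_right_zero[of _ n _ m]) (use B' in \<open>auto simp: dX\<close>)
  then have "X ^ m * det M = X ^ n * char_poly (B * A)"
    using det_mult[OF cL cM] A' B' unfolding LM cpBA
    by (subst (asm) det_four_block_mat_lower_left_zero[of _ n _ m]) (auto simp: dX)
  ultimately show ?thesis by (simp add: X_def)
qed

text \<open>The two root multisets differ only in the number of zeros, and
  \<open>gfun 0 = 0\<close>.\<close>

lemma total_entropy_mult_swap: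
  assumes A: "A \<in> carrier_mat n m" and B: "B \<in> carrier_mat m n"
  shows "total_entropy (A * B) = total_entropy (B * A)"
proof -
  have nz: "char_poly M \<noteq> 0" if "M \<in> carrier_mat k k" for M :: "complex mat" and k
    using degree_monic_char_poly[OF that] by auto
  have rep: "sum_mset (image_mset f (repeat_mset k {#0#})) = of_nat k * f 0" for f :: "complex \<Rightarrow> real" and k
    by (induction k) (auto simp: algebra_simps)
  have "proots ([:0, 1:] ^ m * char_poly (A * B)) = proots ([:0, 1:] ^ n * char_poly (B * A))"
    using char_poly_mult_swap[OF A B] by simp
  then have "repeat_mset m {#0#} + eigvals (A * B) = repeat_mset n {#0#} + eigvals (B * A)"
    using nz[of "A * B" n] nz[of "B * A" m] A B by (simp add: proots_mult proots_power eigvals_def)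
  then have "sum_mset (image_mset (\<lambda>x. gfun (Re x)) (repeat_mset m {#0#} + eigvals (A * B))) =
     sum_mset (image_mset (\<lambda>x. gfun (Re x)) (repeat_mset n {#0#} + eigvals (B * A)))" by simp
  then show ?thesis by (simp add: rep total_entropy_def)
qed

section \<open>Superadditivity of the homogeneous entropy\<close>

lemma cinner_self: "cinner v v = of_real (\<Sum>i<dim_vec v. (cmod (v $ i))^2)"
  unfolding cinner_def of_real_sum
  by (intro sum.cong refl) (metis complex_norm_square mult.commute)

lemma cinner_mat_adjoint:
  assumes "A \<in> carrier_mat n m" "v \<in> carrier_vec n" "w \<in> carrier_vec m"
  shows "cinner v (A *\<^sub>v w) = cinner (mat_adjoint A *\<^sub>v v) w"
proof -
  have "cinner v (A *\<^sub>v w) = (\<Sum>i<n. \<Sum>j<m. cnj (v $ i) * A $$ (i,j) * w $ j)"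
    using assms by (auto simp: cinner_def scalar_prod_def sum_distrib_left lessThan_atLeast0 mult.assoc intro!: sum.cong)
  also have "\<dots> = (\<Sum>j<m. \<Sum>i<n. cnj (v $ i) * A $$ (i,j) * w $ j)" by (rule sum.swap)
  also have "\<dots> = cinner (mat_adjoint A *\<^sub>v v) w"
    using assms by (auto simp: cinner_def scalar_prod_def sum_distrib_right sum_distrib_left lessThan_atLeast0 mult.assoc
        mult.commute mult.left_commute intro!: sum.cong)
  finally show ?thesis .
qed

definition qform :: "complex mat \<Rightarrow> complex vec \<Rightarrow> real" where
  "qform R v = Re (cinner v (R *\<^sub>v v))"

definition psd :: "nat \<Rightarrow> complex mat \<Rightarrow> bool" where
  "psd n R \<longleftrightarrow> R \<in> carrier_mat n n \<and> mat_adjoint R = R \<and> (\<forall>v \<in> carrier_vec n. 0 \<le> qform R v)"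

lemma density_op_iff_psd: "density_op n \<rho> \<longleftrightarrow> psd n \<rho> \<and> trace \<rho> = 1"
  by (auto simp: density_op_def psd_def qform_def)

lemma psd_carrier: "psd n R \<Longrightarrow> R \<in> carrier_mat n n"
  by (simp add: psd_def)

lemma qform_add:
  assumes "A \<in> carrier_mat n n" "B \<in> carrier_mat n n" "v \<in> carrier_vec n"
  shows "qform (A + B) v = qform A v + qform B v"
  using assms by (simp add: qform_def add_mult_distrib_mat_vec[of _ n n] cinner_def distrib_left sum.distrib)

lemma mat_adjoint_add:
  fixes A B :: "complex mat"
  assumes "A \<in> carrier_mat n m" "B \<in> carrier_mat n m"
  shows "mat_adjoint (A + B) = mat_adjoint A + mat_adjoint B"
  by (rule eq_matI) (use assms in auto)

lemma psd_add: "psd n A \<Longrightarrow> psd n B \<Longrightarrow> psd n (A + B)"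
  by (auto simp: psd_def qform_add mat_adjoint_add[of _ n n])

lemma psd_zero: "psd n (0\<^sub>m n n)"
  by (auto simp: psd_def qform_def cinner_def intro!: eq_matI sum_nonneg)

lemma psd_gram:
  assumes A: "A \<in> carrier_mat n m"
  shows "psd n (A * mat_adjoint A)"
proof -
  have "0 \<le> qform (A * mat_adjoint A) v" if v: "v \<in> carrier_vec n" for v
  proof -
    have "cinner v (A * mat_adjoint A *\<^sub>v v) = cinner (mat_adjoint A *\<^sub>v v) (mat_adjoint A *\<^sub>v v)"
      using A v by (simp add: assoc_mult_mat_vec[of _ n m _ n]) (rule cinner_mat_adjoint[of _ n m],
          auto intro: mult_mat_vec_carrier)
    then show ?thesis by (simp add: qform_def cinner_self sum_nonneg)
  qed
  then show ?thesis using A by (simp add: psd_def mat_adjoint_mult[of _ n m _ n])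
qed

lemma trace_unitary_diag:
  assumes "unitary n U"
  shows "trace (U * dmat n d * mat_adjoint U) = of_real (\<Sum>i<n. d i)"
proof -
  note U = unitaryD[OF assms]
  have "trace (U * dmat n d * mat_adjoint U) = trace (mat_adjoint U * (U * dmat n d))"
    using U(1) by (intro trace_mult_comm[of _ n n]) auto
  also have "mat_adjoint U * (U * dmat n d) = (mat_adjoint U * U) * dmat n d"
    using U(1) by (simp add: assoc_mult_mat[of _ n n _ n _ n])
  also have "\<dots> = dmat n d" using U by simp
  finally show ?thesis by (simp add: trace_def dmat_def)
qed

text \<open>Expand column \<open>l\<close> of \<open>V\<close> in the eigenbasis given by
  \<open>U\<close>: the coefficients are the overlaps of the two bases, that is the entries of
  \<open>mat_adjoint U * V\<close>.\<close>

lemma qform_unitary_diag: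
  assumes U: "unitary n U" and V: "unitary n V" and l: "l < n"
  shows "qform (U * dmat n d * mat_adjoint U) (col V l) = (\<Sum>k<n. (cmod ((mat_adjoint U * V) $$ (k,l)))^2 * d k)"
proof -
  note U' = unitaryD[OF U] and V' = unitaryD[OF V]
  define x where "x = mat_adjoint U *\<^sub>v col V l"
  have x: "x \<in> carrier_vec n" using U'(1) V'(1) by (auto simp: x_def intro!: mult_mat_vec_carrier carrier_vecI)
  have xk: "x $ k = (mat_adjoint U * V) $$ (k,l)" if "k < n" for k
    using that U'(1) V'(1) l by (simp add: x_def)
  have vc: "col V l \<in> carrier_vec n" using V'(1) by (auto intro!: carrier_vecI)
  have "cinner (col V l) (U * dmat n d * mat_adjoint U *\<^sub>v col V l) = cinner (col V l) (U *\<^sub>v (dmat n d *\<^sub>v x))"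
    using U'(1) vc x by (simp add: x_def assoc_mult_mat_vec[of _ n n _ n])
  also have "\<dots> = cinner x (dmat n d *\<^sub>v x)"
    using U'(1) vc x by (subst cinner_mat_adjoint[of _ n n]) (auto simp: x_def intro!: mult_mat_vec_carrier[of _ n n])
  also have "dmat n d *\<^sub>v x = vec n (\<lambda>k. of_real (d k) * x $ k)"
    by (rule eq_vecI)
      (use x in \<open>auto simp: dmat_def scalar_prod_def if_distrib[where f="\<lambda>y. y * _"] cong: if_cong\<close>)
  also have "cinner x (vec n (\<lambda>k. of_real (d k) * x $ k)) = (\<Sum>k<n. of_real ((cmod (x $ k))^2 * d k))"
  proof -
    have "cnj z * (of_real a * z) = of_real ((cmod z)^2 * a)" for z a
      by (simp add: complex_norm_square mult_ac del: of_real_power)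
    then show ?thesis using x by (auto simp: cinner_def simp del: of_real_mult intro!: sum.cong)
  qed
  finally show ?thesis by (simp add: qform_def xk)
qed

text \<open>The squared moduli form a doubly stochastic matrix; the sums are the diagonal entries of
  the two products of \<open>T\<close> with its adjoint.\<close>

lemma unitary_entries_sum:
  assumes "unitary n T"
  shows "l < n \<Longrightarrow> (\<Sum>k<n. (cmod (T $$ (k,l)))^2) = 1" "k < n \<Longrightarrow> (\<Sum>l<n. (cmod (T $$ (k,l)))^2) = 1"
proof -
  note T = unitaryD[OF assms]
  have c: "z * cnj z = of_real ((cmod z)^2)" "cnj z * z = of_real ((cmod z)^2)" for z
    by (simp_all add: complex_norm_square mult.commute del: of_real_power)
  show "(\<Sum>k<n. (cmod (T $$ (k,l)))^2) = 1" if "l < n"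
  proof -
    have "(1\<^sub>m n :: complex mat) $$ (l,l) = (mat_adjoint T * T) $$ (l,l)" using T by simp
    also have "\<dots> = of_real (\<Sum>k<n. (cmod (T $$ (k,l)))^2)"
      using T(1) that by (simp add: mat_mult_index c del: index_mult_mat(1) of_real_power)
    finally show ?thesis using that by (simp del: of_real_sum)
  qed
  show "(\<Sum>l<n. (cmod (T $$ (k,l)))^2) = 1" if "k < n"
  proof -
    have "(1\<^sub>m n :: complex mat) $$ (k,k) = (T * mat_adjoint T) $$ (k,k)" using T by simp
    also have "\<dots> = of_real (\<Sum>l<n. (cmod (T $$ (k,l)))^2)"
      using T(1) that by (simp add: mat_mult_index c del: index_mult_mat(1) of_real_power)
    finally show ?thesis using that by (simp del: of_real_sum)
  qed
qed

text \<open>Each eigenvalue is also recorded as the quadratic form at its eigenvector. This gives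
  nonnegativity, and it is additive in the operator, which lets the eigenvalues of a sum be
  split.\<close>

lemma psd_spectral:
  assumes "psd n R"
  obtains U d where "unitary n U" "R = U * dmat n d * mat_adjoint U"
    "\<And>k. k < n \<Longrightarrow> d k = qform R (col U k)" "\<And>k. k < n \<Longrightarrow> 0 \<le> d k" "trace R = of_real (\<Sum>k<n. d k)"
proof -
  obtain U d where U: "unitary n U" and R: "R = U * dmat n d * mat_adjoint U"
    using hermitian_spectral[of R n] assms by (auto simp: psd_def)
  note U' = unitaryD[OF U]
  have dk: "d k = qform R (col U k)" if k: "k < n" for k
  proof -
    have "qform R (col U k) = (\<Sum>j<n. (cmod ((1\<^sub>m n :: complex mat) $$ (j,k)))^2 * d j)"
      unfolding R qform_unitary_diag[OF U U k] U'(3) ..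
    also have "\<dots> = (\<Sum>j<n. if j = k then d j else 0)" using k by (intro sum.cong) auto
    also have "\<dots> = d k" using k by simp
    finally show ?thesis ..
  qed
  moreover have "0 \<le> d k" if "k < n" for k
  proof -
    have "col U k \<in> carrier_vec n" using U'(1) by (auto intro!: carrier_vecI)
    then show ?thesis using assms dk[OF that] by (simp add: psd_def)
  qed
  ultimately show ?thesis using that[OF U R] trace_unitary_diag[OF U, of d] by (simp add: R[symmetric])
qed

text \<open>The total entropy extended homogeneously to unnormalised positive operators; the value
  at trace 0 is 0.\<close>

definition hent :: "complex mat \<Rightarrow> real" where
  "hent R = Re (trace R) * total_entropy ((1 / trace R) \<cdot>\<^sub>m R)"

text \<open>The perspective of \<open>gfun\<close>. The perspective of a concave function is jointly
  concave and homogeneous, hence superadditive.\<close>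

definition gpersp :: "real \<Rightarrow> real \<Rightarrow> real" where
  "gpersp x t = t * gfun (x / t)"

text \<open>Jensen for \<open>gfun\<close> at x/s and y/t with weights s/(s+t) and t/(s+t),
  multiplied by s+t. The bounds keep both arguments in [0,1] and force \<open>x = 0\<close> when
  \<open>s = 0\<close>.\<close>

lemma gpersp_superadditive:
  assumes "0 \<le> x" "x \<le> s" "0 \<le> y" "y \<le> t"
  shows "gpersp x s + gpersp y t \<le> gpersp (x + y) (s + t)"
proof (cases "s = 0 \<or> t = 0")
  case True
  then show ?thesis using assms by (auto simp: gpersp_def)
next
  case False
  then have st: "s > 0" "t > 0" using assms by auto
  define w where "w b = (if b then s / (s + t) else t / (s + t))" for b
  define z where "z b = (if b then x / s else y / t)" for b
  have w1: "s / (s + t) + t / (s + t) = 1" using st by (simp add: add_divide_distrib[symmetric])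
  have "(\<Sum>b\<in>UNIV. w b * gfun (z b)) \<le> gfun (\<Sum>b\<in>UNIV. w b * z b)"
    using st assms w1 by (intro gfun_jensen) (auto simp: w_def z_def UNIV_bool)
  moreover have "(\<Sum>b\<in>UNIV. w b * z b) = (x + y) / (s + t)"
    using st by (simp add: w_def z_def UNIV_bool add_divide_distrib)
  ultimately have "s / (s + t) * gfun (x / s) + t / (s + t) * gfun (y / t) \<le> gfun ((x + y) / (s + t))"
    by (simp add: w_def z_def UNIV_bool)
  then have "(s + t) * (s / (s + t) * gfun (x / s) + t / (s + t) * gfun (y / t)) \<le> (s + t) * gfun ((x + y) / (s + t))"
    using st by (intro mult_left_mono) auto
  then show ?thesis using st by (simp add: gpersp_def distrib_left)
qed

text \<open>The normalised operator has the eigenvalues \<open>d k / t\<close>; at trace 0 both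
  sides are 0.\<close>

lemma hent_unitary_diag:
  assumes "unitary n U" "R = U * dmat n d * mat_adjoint U" "t = (\<Sum>k<n. d k)"
  shows "hent R = (\<Sum>k<n. gpersp (d k) t)"
proof -
  note U = unitaryD[OF assms(1)]
  have tr: "trace R = of_real t" using trace_unitary_diag[OF assms(1)] assms by simp
  have "(1 / trace R) \<cdot>\<^sub>m R = U * ((1 / trace R) \<cdot>\<^sub>m dmat n d) * mat_adjoint U"
    using U by (simp add: assms(2) mult_smult_distrib[of _ n n _ n] mult_smult_assoc_mat[of _ n n _ n])
  also have "(1 / trace R) \<cdot>\<^sub>m dmat n d = dmat n (\<lambda>k. d k / t)"
    by (rule eq_matI) (auto simp: dmat_def tr)
  finally show ?thesis
    by (simp add: hent_def total_entropy_unitary_diag[OF assms(1)] tr gpersp_def sum_distrib_left)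
qed

text \<open>A diagonal entry is a sum of eigenvalues with weights in [0,1]. These are the domain
  conditions under which \<open>gpersp\<close> is superadditive.\<close>

lemma qform_psd_bounds:
  assumes R: "psd n R" and V: "unitary n V" and l: "l < n"
  shows "0 \<le> qform R (col V l)" "qform R (col V l) \<le> Re (trace R)"
proof -
  obtain U d where U: "unitary n U" and RU: "R = U * dmat n d * mat_adjoint U"
    and d: "\<And>k. k < n \<Longrightarrow> 0 \<le> d k" and tr: "trace R = of_real (\<Sum>k<n. d k)"
    using psd_spectral[OF R] by metis
  have T: "unitary n (mat_adjoint U * V)"
    using unitary_mult[of n "mat_adjoint U" V] V unitaryD[OF U] by (simp add: unitary_def)
  have q: "qform R (col V l) = (\<Sum>k<n. (cmod ((mat_adjoint U * V) $$ (k,l)))^2 * d k)"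
    unfolding RU by (rule qform_unitary_diag[OF U V l])
  show "0 \<le> qform R (col V l)" unfolding q using d by (intro sum_nonneg) auto
  have "(cmod ((mat_adjoint U * V) $$ (k,l)))^2 \<le> 1" if "k < n" for k
    using unitary_entries_sum(1)[OF T l]
      member_le_sum[of k "{..<n}" "\<lambda>k. (cmod ((mat_adjoint U * V) $$ (k,l)))^2"] that
    by (simp del: index_mult_mat)
  then show "qform R (col V l) \<le> Re (trace R)"
    unfolding q tr using d by (auto simp del: index_mult_mat intro!: sum_mono mult_left_le_one_le)
qed

text \<open>The diagonal of an operator in any orthonormal basis is a doubly stochastic image of its
  spectrum.\<close>

lemma hent_le_diagonal:
  assumes R: "psd n R" and V: "unitary n V"
  shows "hent R \<le> (\<Sum>l<n. gpersp (qform R (col V l)) (Re (trace R)))"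
proof -
  obtain U d where U: "unitary n U" and RU: "R = U * dmat n d * mat_adjoint U"
    and d: "\<And>k. k < n \<Longrightarrow> 0 \<le> d k" and tr: "trace R = of_real (\<Sum>k<n. d k)"
    using psd_spectral[OF R] by metis
  define t where "t = (\<Sum>k<n. d k)"
  have t0: "t \<ge> 0" using d by (auto simp: t_def intro!: sum_nonneg)
  have dt: "d k \<le> t" if "k < n" for k
    unfolding t_def using d that by (intro member_le_sum) auto
  have T: "unitary n (mat_adjoint U * V)"
    using unitary_mult[of n "mat_adjoint U" V] V unitaryD[OF U] by (simp add: unitary_def)
  define w where "w k l = (cmod ((mat_adjoint U * V) $$ (k,l)))^2" for k l
  have w: "\<And>l. l < n \<Longrightarrow> (\<Sum>k<n. w k l) = 1" "\<And>k. k < n \<Longrightarrow> (\<Sum>l<n. w k l) = 1" "\<And>k l. 0 \<le> w k l"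
    using unitary_entries_sum[OF T] by (auto simp: w_def)
  have q: "qform R (col V l) = (\<Sum>k<n. w k l * d k)" if "l < n" for l
    unfolding RU w_def by (rule qform_unitary_diag[OF U V that])
  \<comment> \<open>The weights can be inserted because they sum to 1 over \<open>l\<close>; that
    they sum to 1 over \<open>k\<close> serves Jensen below.\<close>
  have "hent R = (\<Sum>k<n. (\<Sum>l<n. w k l) * gpersp (d k) t)"
    using w by (simp add: hent_unitary_diag[OF U RU t_def])
  also have "\<dots> = (\<Sum>k<n. \<Sum>l<n. w k l * gpersp (d k) t)" by (simp add: sum_distrib_right)
  also have "\<dots> = (\<Sum>l<n. \<Sum>k<n. w k l * gpersp (d k) t)" by (rule sum.swap)
  also have "\<dots> \<le> (\<Sum>l<n. gpersp (qform R (col V l)) t)"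
  proof (rule sum_mono)
    fix l assume "l \<in> {..<n}"
    then have l: "l < n" by simp
    have "(\<Sum>k<n. w k l * gfun (d k / t)) \<le> gfun (\<Sum>k<n. w k l * (d k / t))"
      using w l d dt t0 by (intro gfun_jensen) (auto simp: divide_le_eq_1)
    then have "t * (\<Sum>k<n. w k l * gfun (d k / t)) \<le> t * gfun (\<Sum>k<n. w k l * (d k / t))"
      using t0 by (rule mult_left_mono)
    then show "(\<Sum>k<n. w k l * gpersp (d k) t) \<le> gpersp (qform R (col V l)) t"
      by (simp add: gpersp_def q[OF l] sum_distrib_left sum_divide_distrib mult.left_commute)
  qed
  finally show ?thesis by (simp add: tr t_def)
qed

text \<open>Compare in an eigenbasis of \<open>A + B\<close>. Replacing the spectra of
  \<open>A\<close> and \<open>B\<close> by their diagonals there does not decrease the left side,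
  and these diagonals add up to the spectrum of the sum; what remains is the scalar
  inequality.\<close>

lemma hent_superadditive:
  assumes A: "psd n A" and B: "psd n B"
  shows "hent A + hent B \<le> hent (A + B)"
proof -
  note c = psd_carrier[OF A] psd_carrier[OF B]
  obtain U d where U: "unitary n U" and RU: "A + B = U * dmat n d * mat_adjoint U"
    and dq: "\<And>k. k < n \<Longrightarrow> d k = qform (A + B) (col U k)" and tr: "trace (A + B) = of_real (\<Sum>k<n. d k)"
    using psd_spectral[OF psd_add[OF A B]] by metis
  have t: "(\<Sum>k<n. d k) = Re (trace A) + Re (trace B)"
    using tr trace_add[OF c] by (simp add: complex_eq_iff)
  have uc: "col U k \<in> carrier_vec n" for k using unitaryD(1)[OF U] by (auto intro!: carrier_vecI)
  have "hent A + hent B \<le> (\<Sum>l<n. gpersp (qform A (col U l)) (Re (trace A)) + gpersp (qform B (col U l)) (Re (trace B)))"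
    using hent_le_diagonal[OF A U] hent_le_diagonal[OF B U] by (simp add: sum.distrib)
  also have "\<dots> \<le> (\<Sum>l<n. gpersp (d l) (Re (trace A) + Re (trace B)))"
    using qform_psd_bounds[OF A U] qform_psd_bounds[OF B U]
    by (intro sum_mono) (auto simp: dq qform_add[OF c uc] intro!: gpersp_superadditive)
  also have "\<dots> = hent (A + B)" by (rule hent_unitary_diag[OF U RU t[symmetric], symmetric])
  finally show ?thesis .
qed

text \<open>The lower bound is the linear entropy: t^2 minus the sum of the d_k^2 is the sum of t^2
  x(1-x) over x = d_k/t. The trace on the right makes both sides homogeneous of degree two, so that
  trace 0 is included.\<close>

lemma hent_nonneg_lower:
  assumes R: "psd n R"
  shows "0 \<le> hent R" "(Re (trace R))^2 - Re (trace (R * R)) \<le> Re (trace R) * hent R"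
proof -
  obtain U d where U: "unitary n U" and RU: "R = U * dmat n d * mat_adjoint U"
    and d: "\<And>k. k < n \<Longrightarrow> 0 \<le> d k" and tr: "trace R = of_real (\<Sum>k<n. d k)"
    using psd_spectral[OF R] by metis
  note U' = unitaryD[OF U]
  define t where "t = (\<Sum>k<n. d k)"
  have t0: "t \<ge> 0" using d by (auto simp: t_def intro!: sum_nonneg)
  have dt: "d k \<le> t" if "k < n" for k
    unfolding t_def using d that by (intro member_le_sum) auto
  have h: "hent R = (\<Sum>k<n. gpersp (d k) t)" by (rule hent_unitary_diag[OF U RU t_def])
  show "0 \<le> hent R" unfolding h gpersp_def
    using d dt t0 by (intro sum_nonneg mult_nonneg_nonneg gfun_nonneg) (auto simp: divide_le_eq_1)
  have "R * R = U * dmat n d * (mat_adjoint U * U) * dmat n d * mat_adjoint U"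
    using U'(1) by (simp add: RU assoc_mult_mat[of _ n n _ n _ n])
  also have "\<dots> = U * (dmat n d * dmat n d) * mat_adjoint U"
    unfolding U'(3) using U'(1) by (simp add: assoc_mult_mat[of _ n n _ n _ n])
  also have "dmat n d * dmat n d = dmat n (\<lambda>k. (d k)^2)"
    by (rule eq_matI)
      (auto simp: dmat_def mat_mult_index power2_eq_square if_distrib[where f="\<lambda>y. y * _"] simp del: index_mult_mat(1) cong: if_cong)
  finally have tr2: "trace (R * R) = of_real (\<Sum>k<n. (d k)^2)" using trace_unitary_diag[OF U] by simp
  have "t^2 - (\<Sum>k<n. (d k)^2) \<le> t * (\<Sum>k<n. gpersp (d k) t)"
  proof (cases "t = 0")
    case True
    then show ?thesis by (simp add: sum_nonneg)
  next
    case False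
    with t0 have t: "t > 0" by simp
    have "t^2 - (\<Sum>k<n. (d k)^2) = (\<Sum>k<n. t^2 * (d k / t * (1 - d k / t)))"
      using t by (simp add: algebra_simps power2_eq_square sum_subtractf sum_distrib_left[symmetric] t_def[symmetric])
    also have "\<dots> \<le> (\<Sum>k<n. t^2 * gfun (d k / t))"
      using d dt t by (intro sum_mono mult_left_mono gfun_lower) auto
    finally show ?thesis by (simp add: gpersp_def sum_distrib_left power2_eq_square mult.assoc)
  qed
  then show "(Re (trace R))^2 - Re (trace (R * R)) \<le> Re (trace R) * hent R"
    unfolding h by (simp add: tr tr2 t_def)
qed

lemma hent_smult:
  assumes "R \<in> carrier_mat n n"
  shows "hent (of_real s \<cdot>\<^sub>m R) = s * hent R"
proof (cases "s = 0")
  case False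
  have "1 / (of_real s * trace R) * of_real s = 1 / trace R" using False by simp
  then have "(1 / (of_real s * trace R)) \<cdot>\<^sub>m (of_real s \<cdot>\<^sub>m R) = (1 / trace R) \<cdot>\<^sub>m R"
    by (intro eq_matI) (simp_all add: mult.assoc[symmetric])
  then show ?thesis by (simp add: hent_def trace_smult[OF assms])
qed (simp add: hent_def trace_smult[OF assms])

text \<open>Applied to a coefficient matrix and its adjoint, this trades the reduced operator of one
  party for the transpose of the other one.\<close>

lemma hent_mult_swap:
  assumes A: "A \<in> carrier_mat n m" and B: "B \<in> carrier_mat m n"
  shows "hent (A * B) = hent (B * A)"
proof -
  have "total_entropy (c \<cdot>\<^sub>m (A * B)) = total_entropy (c \<cdot>\<^sub>m (B * A))" for c
  proof -
    have "c \<cdot>\<^sub>m (A * B) = (c \<cdot>\<^sub>m A) * B" using A B by (simp add: mult_smult_assoc_mat[of _ n m _ n])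
    also have "total_entropy \<dots> = total_entropy (B * (c \<cdot>\<^sub>m A))"
      using A B by (intro total_entropy_mult_swap[of _ n m]) auto
    also have "B * (c \<cdot>\<^sub>m A) = c \<cdot>\<^sub>m (B * A)" using A B by (simp add: mult_smult_distrib[of _ m n _ m])
    finally show ?thesis .
  qed
  then show ?thesis by (simp add: hent_def trace_mult_comm[OF A B])
qed

text \<open>After normalisation the only eigenvalue is 1, and \<open>gfun 1 = 0\<close>; trace 0 is
  covered by the prefactor.\<close>

lemma hent_dim_1:
  assumes "R \<in> carrier_mat 1 1"
  shows "hent R = 0"
proof (cases "trace R = 0")
  case False
  then have R: "R $$ (0,0) \<noteq> 0" and tr: "trace R = R $$ (0,0)" using assms by (auto simp: trace_def)
  have "char_poly ((1 / trace R) \<cdot>\<^sub>m R) = (\<Prod>a\<leftarrow>diag_mat ((1 / trace R) \<cdot>\<^sub>m R). [:- a, 1:])"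
    using assms by (intro char_poly_upper_triangular[of _ 1]) auto
  also have "diag_mat ((1 / trace R) \<cdot>\<^sub>m R) = [1]" using assms R by (simp add: diag_mat_def tr)
  finally have "total_entropy ((1 / trace R) \<cdot>\<^sub>m R) = 0"
    by (subst total_entropy_char_poly[where as = "[1]"]) auto
  then show ?thesis by (simp add: hent_def)
qed (simp add: hent_def)

section \<open>Finite sums of positive operators\<close>

lemma msum_carrier [simp]: "msum r c Ms \<in> carrier_mat r c"
  by (simp add: msum_def)

lemma msum_dim [simp]: "dim_row (msum r c Ms) = r" "dim_col (msum r c Ms) = c"
  by (simp_all add: msum_def)

lemma msum_Nil [simp]: "msum r c [] = 0\<^sub>m r c"
  by (rule eq_matI) (auto simp: msum_def)

lemma msum_Cons: "M \<in> carrier_mat r c \<Longrightarrow> msum r c (M # Ms) = M + msum r c Ms"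
  by (rule eq_matI) (auto simp: msum_def)

lemma msum_append: "msum r c (Ms @ Ns) = msum r c Ms + msum r c Ns"
  by (rule eq_matI) (auto simp: msum_def)

lemma psd_msum: "(\<And>R. R \<in> set Rs \<Longrightarrow> psd n R) \<Longrightarrow> psd n (msum n n Rs)"
  by (induction Rs) (auto simp: msum_Cons psd_zero psd_carrier intro!: psd_add)

lemma hent_msum:
  assumes "\<And>R. R \<in> set Rs \<Longrightarrow> psd n R"
  shows "(\<Sum>R\<leftarrow>Rs. hent R) \<le> hent (msum n n Rs)"
  using assms
proof (induction Rs)
  case Nil
  then show ?case by (simp add: hent_def trace_def)
next
  case (Cons R Rs)
  then have "hent R + hent (msum n n Rs) \<le> hent (R + msum n n Rs)"
    by (intro hent_superadditive[of n] psd_msum) auto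
  with Cons show ?case by (simp add: msum_Cons psd_carrier)
qed

section \<open>Bipartite vectors and LOCC protocols\<close>

lemma sum_product_index:
  fixes f :: "nat \<Rightarrow> 'a::comm_monoid_add"
  shows "(\<Sum>x<a*b. f x) = (\<Sum>i<a. \<Sum>k<b. f (i*b + k))"
proof -
  have "(\<Sum>x<a*b. f x) = (\<Sum>i<a. sum f {i*b..<i*b+b})" by (simp add: sum.nat_group)
  also have "\<dots> = (\<Sum>i<a. \<Sum>k<b. f (i*b + k))"
  proof (rule sum.cong[OF refl])
    fix i
    show "sum f {i*b..<i*b+b} = (\<Sum>k<b. f (i*b + k))"
      using sum.shift_bounds_nat_ivl[of f 0 "i*b" b] by (simp add: lessThan_atLeast0 add.commute)
  qed
  finally show ?thesis .
qed

lemma product_index_less: "i < a \<Longrightarrow> k < b \<Longrightarrow> i * b + k < a * (b::nat)"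
proof -
  assume "i < a" "k < b"
  then have "i * b + k < Suc i * b" by simp
  also have "\<dots> \<le> a * b" using \<open>i < a\<close> by (intro mult_le_mono1) auto
  finally show ?thesis .
qed

lemma product_index_div_mod:
  assumes "x < a * (b::nat)"
  shows "x div b < a" "x mod b < b" "(x div b) * b + x mod b = x"
proof -
  have "b > 0" using assms by (cases b) auto
  then show "x div b < a" "x mod b < b" "(x div b) * b + x mod b = x"
    using assms by (auto simp: less_mult_imp_div_less)
qed

text \<open>The tensor product seen as matrices: operators on A act by left multiplication,
  operators on B by right multiplication with the transpose, and C times its adjoint is the reduced
  operator of A.\<close>

definition coefmat :: "nat \<Rightarrow> nat \<Rightarrow> complex vec \<Rightarrow> complex mat" where
  "coefmat a b v = mat a b (\<lambda>(i,k). v $ (i*b + k))"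

lemma coefmat_carrier [simp]: "coefmat a b v \<in> carrier_mat a b"
  by (simp add: coefmat_def)

lemma coefmat_dim [simp]: "dim_row (coefmat a b v) = a" "dim_col (coefmat a b v) = b"
  by (simp_all add: coefmat_def)

lemma coefmat_index [simp]: "i < a \<Longrightarrow> k < b \<Longrightarrow> coefmat a b v $$ (i,k) = v $ (i*b + k)"
  by (simp add: coefmat_def)

lemma ptrace_B_proj:
  assumes "v \<in> carrier_vec (a*b)"
  shows "ptrace_B a b (proj v) = coefmat a b v * mat_adjoint (coefmat a b v)"
  by (rule eq_matI)
     (use assms in \<open>auto simp: ptrace_B_def proj_def mat_mult_index product_index_less simp del: index_mult_mat(1)\<close>)

lemma trace_gram_coefmat:
  assumes "v \<in> carrier_vec (a*b)"
  shows "trace (coefmat a b v * mat_adjoint (coefmat a b v)) = cinner v v"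
  using assms
  by (simp add: trace_def mat_mult_index cinner_def sum_product_index product_index_less mult.commute del: index_mult_mat(1))

text \<open>Meant for unnormalised vectors: sqrt(p) times a unit vector has p times the cost of that
  vector, so the weights of an ensemble need no separate bookkeeping.\<close>

definition cost :: "nat \<Rightarrow> nat \<Rightarrow> complex vec \<Rightarrow> real" where
  "cost a b v = hent (coefmat a b v * mat_adjoint (coefmat a b v))"

lemma cost_nonneg: "0 \<le> cost a b v"
  unfolding cost_def by (rule hent_nonneg_lower(1)[OF psd_gram]) auto

lemma Et_pure_unit:
  assumes "unit_vec (a*b) v"
  shows "Et_pure a b v = cost a b v / rnorm a"
proof -
  have v: "v \<in> carrier_vec (a*b)" "cinner v v = 1" using assms by (auto simp: unit_vec_def)
  have one: "1 \<cdot>\<^sub>m M = M" for M :: "complex mat" by (rule eq_matI) auto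
  show ?thesis
    by (simp add: Et_pure_def cost_def hent_def trace_gram_coefmat[OF v(1)] ptrace_B_proj[OF v(1)] v(2) one)
qed

lemma cost_smult:
  assumes v: "v \<in> carrier_vec (a*b)"
  shows "cost a b (c \<cdot>\<^sub>v v) = (cmod c)^2 * cost a b v"
proof -
  have "coefmat a b (c \<cdot>\<^sub>v v) * mat_adjoint (coefmat a b (c \<cdot>\<^sub>v v)) =
    of_real ((cmod c)^2) \<cdot>\<^sub>m (coefmat a b v * mat_adjoint (coefmat a b v))"
    by (rule eq_matI) (use v in \<open>auto simp: mat_mult_index product_index_less sum_distrib_left
        complex_norm_square mult_ac simp del: index_mult_mat(1) of_real_power intro!: sum.cong\<close>)
  then show ?thesis by (simp add: cost_def hent_smult[of _ a] del: of_real_power)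
qed

section \<open>Rank-one projectors and unnormalised ensembles\<close>

lemma proj_carrier: "v \<in> carrier_vec n \<Longrightarrow> proj v \<in> carrier_mat n n"
  by (auto simp: proj_def)

lemma proj_smult: "proj (c \<cdot>\<^sub>v v) = of_real ((cmod c)^2) \<cdot>\<^sub>m proj v"
  by (rule eq_matI) (auto simp: proj_def complex_norm_square mult_ac simp del: of_real_power)

lemma trace_proj: "trace (proj v) = cinner v v"
  by (simp add: trace_def proj_def cinner_def mult.commute)

lemma proj_gram: "proj v = mat (dim_vec v) 1 (\<lambda>(i,_). v $ i) * mat_adjoint (mat (dim_vec v) 1 (\<lambda>(i,_). v $ i))"
  by (rule eq_matI) (auto simp: proj_def mat_mult_index simp del: index_mult_mat(1))

lemma proj_mult_mat_vec:
  assumes K: "K \<in> carrier_mat m n" and v: "v \<in> carrier_vec n"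
  shows "K * proj v * mat_adjoint K = proj (K *\<^sub>v v)"
proof -
  define A where "A = mat n 1 (\<lambda>(i,_). v $ i)"
  have A: "A \<in> carrier_mat n 1" by (simp add: A_def)
  have KA: "K * A = mat (dim_vec (K *\<^sub>v v)) 1 (\<lambda>(i,_). (K *\<^sub>v v) $ i)"
    by (rule eq_matI) (use K v in \<open>auto simp: A_def scalar_prod_def intro!: sum.cong\<close>)
  have "proj v = A * mat_adjoint A" using v by (simp add: proj_gram A_def)
  then have "K * proj v * mat_adjoint K = (K * A) * mat_adjoint (K * A)"
    using K A by (simp add: mat_adjoint_mult[OF K A] assoc_mult_mat[of _ m n _ 1 _ m]
        assoc_mult_mat[of _ m n _ n _ m] assoc_mult_mat[of _ n 1 _ n _ m])
  then show ?thesis by (simp add: proj_gram[of "K *\<^sub>v v"] KA)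
qed

text \<open>Probabilities are absorbed into the norms: adding operators is concatenating lists, and
  a Kraus operator maps the vectors one by one. Zero vectors are allowed and later serve as
  padding.\<close>

definition ensemble :: "nat \<Rightarrow> complex vec list \<Rightarrow> complex mat" where
  "ensemble n V = msum n n (map proj V)"

lemma ensemble_carrier [simp]: "ensemble n V \<in> carrier_mat n n"
  by (simp add: ensemble_def)

lemma ensemble_dim [simp]: "dim_row (ensemble n V) = n" "dim_col (ensemble n V) = n"
  by (simp_all add: ensemble_def)

lemma ensemble_append: "ensemble n (V @ W) = ensemble n V + ensemble n W"
  by (simp add: ensemble_def msum_append)

lemma ensemble_Nil [simp]: "ensemble n [] = 0\<^sub>m n n"
  by (simp add: ensemble_def)

lemma ensemble_Cons: "v \<in> carrier_vec n \<Longrightarrow> ensemble n (v # V) = proj v + ensemble n V"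
  by (simp add: ensemble_def msum_Cons proj_carrier)

lemma ensemble_concat: "ensemble n (concat Vs) = msum n n (map (ensemble n) Vs)"
  by (induction Vs) (auto simp: ensemble_append msum_Cons)

lemma trace_ensemble:
  assumes "set V \<subseteq> carrier_vec n"
  shows "trace (ensemble n V) = (\<Sum>v\<leftarrow>V. cinner v v)"
  using assms
proof (induction V)
  case Nil
  then show ?case by (simp add: trace_def)
next
  case (Cons v V)
  then show ?case by (simp add: ensemble_Cons trace_add[of _ n] proj_carrier trace_proj)
qed

lemma ensemble_smult:
  assumes "set V \<subseteq> carrier_vec n"
  shows "ensemble n (map (\<lambda>v. c \<cdot>\<^sub>v v) V) = of_real ((cmod c)^2) \<cdot>\<^sub>m ensemble n V"
  using assms
proof (induction V)
  case (Cons v V)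
  then show ?case
    by (simp add: ensemble_Cons proj_smult add_smult_distrib_left_mat[of _ n n] proj_carrier del: of_real_power)
qed (auto intro!: eq_matI)

lemma msum_conj:
  assumes "\<And>M. M \<in> set Ms \<Longrightarrow> M \<in> carrier_mat n m" "L \<in> carrier_mat k n" "R \<in> carrier_mat m l"
  shows "L * msum n m Ms * R = msum k l (map (\<lambda>M. L * M * R) Ms)"
  using assms(1)
proof (induction Ms)
  case Nil
  then show ?case using assms by (auto intro!: eq_matI)
next
  case (Cons M Ms)
  then have M: "M \<in> carrier_mat n m" by simp
  have "L * (M + msum n m Ms) * R = L * M * R + L * msum n m Ms * R"
    by (simp only: mult_add_distrib_mat[OF assms(2) M msum_carrier]
        add_mult_distrib_mat[OF mult_carrier_mat[OF assms(2) M] mult_carrier_mat[OF assms(2) msum_carrier] assms(3)])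
  moreover have "L * msum n m Ms * R = msum k l (map (\<lambda>M. L * M * R) Ms)"
    using Cons by simp
  moreover have "L * M * R \<in> carrier_mat k l" using assms(2,3) by simp
  ultimately show ?case using M by (simp only: msum_Cons list.map)
qed

lemma kraus_apply_ensemble:
  assumes V: "set V \<subseteq> carrier_vec m" and K: "\<And>K. K \<in> set Ks \<Longrightarrow> K \<in> carrier_mat n m"
  shows "kraus_apply n Ks (ensemble m V) = ensemble n (concat (map (\<lambda>K. map (\<lambda>v. K *\<^sub>v v) V) Ks))"
proof -
  have "K * ensemble m V * mat_adjoint K = ensemble n (map (\<lambda>v. K *\<^sub>v v) V)" if "K \<in> set Ks" for K
  proof -
    have "K * ensemble m V * mat_adjoint K = msum n n (map (\<lambda>v. K * proj v * mat_adjoint K) V)"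
      unfolding ensemble_def
      by (subst msum_conj[of _ m m _ n _ n]) (use V K[OF that] in \<open>auto simp: proj_carrier o_def\<close>)
    also have "map (\<lambda>v. K * proj v * mat_adjoint K) V = map proj (map (\<lambda>v. K *\<^sub>v v) V)"
      using V K[OF that] by (auto intro!: proj_mult_mat_vec)
    finally show ?thesis by (simp add: ensemble_def)
  qed
  then have "kraus_apply n Ks (ensemble m V) = msum n n (map (\<lambda>K. ensemble n (map (\<lambda>v. K *\<^sub>v v) V)) Ks)"
    unfolding kraus_apply_def by (intro arg_cong[where f="msum n n"] map_cong) auto
  then show ?thesis by (simp add: ensemble_concat o_def)
qed

lemma kron_carrier: "A \<in> carrier_mat n m \<Longrightarrow> B \<in> carrier_mat k l \<Longrightarrow> kron A B \<in> carrier_mat (n*k) (m*l)"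
  by (auto simp: kron_def)

lemma kron_dim [simp]: "dim_row (kron A B) = dim_row A * dim_row B" "dim_col (kron A B) = dim_col A * dim_col B"
  by (simp_all add: kron_def)

lemma kron_mult_vec_index:
  assumes "A \<in> carrier_mat n m" "B \<in> carrier_mat k l" "v \<in> carrier_vec (m*l)" "i < n" "j < k"
  shows "(kron A B *\<^sub>v v) $ (i*k + j) = (\<Sum>p<m. \<Sum>q<l. A $$ (i,p) * B $$ (j,q) * v $ (p*l + q))"
proof -
  have "(kron A B *\<^sub>v v) $ (i*k + j) = (\<Sum>x<m*l. kron A B $$ (i*k + j, x) * v $ x)"
    using assms by (auto simp: scalar_prod_def product_index_less lessThan_atLeast0 intro!: sum.cong)
  also have "\<dots> = (\<Sum>p<m. \<Sum>q<l. kron A B $$ (i*k + j, p*l + q) * v $ (p*l + q))"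
    by (rule sum_product_index)
  also have "\<dots> = (\<Sum>p<m. \<Sum>q<l. A $$ (i,p) * B $$ (j,q) * v $ (p*l + q))"
    using assms by (intro sum.cong refl) (auto simp: kron_def product_index_less)
  finally show ?thesis .
qed

lemma coefmat_kron_left:
  assumes K: "K \<in> carrier_mat a' a" and v: "v \<in> carrier_vec (a*b)"
  shows "coefmat a' b (kron K (1\<^sub>m b) *\<^sub>v v) = K * coefmat a b v"
proof (rule eq_matI)
  fix i k assume "i < dim_row (K * coefmat a b v)" "k < dim_col (K * coefmat a b v)"
  then have ik: "i < a'" "k < b" using K by auto
  have "coefmat a' b (kron K (1\<^sub>m b) *\<^sub>v v) $$ (i,k) =
      (\<Sum>p<a. \<Sum>q<b. K $$ (i,p) * (1\<^sub>m b :: complex mat) $$ (k,q) * v $ (p*b + q))"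
    using ik kron_mult_vec_index[OF K _ v, of "1\<^sub>m b" b i k] by simp
  also have "\<dots> = (\<Sum>p<a. \<Sum>q<b. if q = k then K $$ (i,p) * v $ (p*b + k) else 0)"
    using ik by (intro sum.cong refl) auto
  also have "\<dots> = (K * coefmat a b v) $$ (i,k)"
    using ik K by (simp add: mat_mult_index del: index_mult_mat(1))
  finally show "coefmat a' b (kron K (1\<^sub>m b) *\<^sub>v v) $$ (i,k) = (K * coefmat a b v) $$ (i,k)" .
qed (use K in auto)

lemma coefmat_kron_right:
  assumes K: "K \<in> carrier_mat b' b" and v: "v \<in> carrier_vec (a*b)"
  shows "coefmat a b' (kron (1\<^sub>m a) K *\<^sub>v v) = coefmat a b v * transpose_mat K"
proof (rule eq_matI)
  fix i k assume "i < dim_row (coefmat a b v * transpose_mat K)" "k < dim_col (coefmat a b v * transpose_mat K)"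
  then have ik: "i < a" "k < b'" using K by auto
  have "coefmat a b' (kron (1\<^sub>m a) K *\<^sub>v v) $$ (i,k) =
      (\<Sum>p<a. \<Sum>q<b. (1\<^sub>m a :: complex mat) $$ (i,p) * K $$ (k,q) * v $ (p*b + q))"
    using ik kron_mult_vec_index[OF _ K v, of "1\<^sub>m a" a i k] by simp
  also have "\<dots> = (\<Sum>p<a. if p = i then \<Sum>q<b. K $$ (k,q) * v $ (i*b + q) else 0)"
    using ik by (intro sum.cong refl) auto
  also have "\<dots> = (coefmat a b v * transpose_mat K) $$ (i,k)"
    using ik K by (simp add: mat_mult_index mult.commute del: index_mult_mat(1))
  finally show "coefmat a b' (kron (1\<^sub>m a) K *\<^sub>v v) $$ (i,k) = (coefmat a b v * transpose_mat K) $$ (i,k)" .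
qed (use K in auto)

text \<open>A local operation of one party leaves the sum of the reduced operators of the other party
  unchanged, and both reduced operators have the same nonzero spectrum.\<close>

lemma cost_local_A:
  assumes v: "v \<in> carrier_vec (a*b)" and K: "\<And>K. K \<in> set Ks \<Longrightarrow> \<exists>a'. K \<in> carrier_mat a' a"
    and sum1: "msum a a (map (\<lambda>K. mat_adjoint K * K) Ks) = 1\<^sub>m a"
  shows "(\<Sum>K\<leftarrow>Ks. cost (dim_row K) b (kron K (1\<^sub>m b) *\<^sub>v v)) \<le> cost a b v"
proof -
  define P where "P = coefmat a b v"
  have P: "P \<in> carrier_mat a b" by (simp add: P_def)
  \<comment> \<open>The Gram matrix of \<open>K * P\<close> on the side of B. It has size
    \<open>b\<close> whatever the output dimension of \<open>K\<close>, so the operators of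
    different outcomes can be added, and completeness of the Kraus operators collapses their
    sum.\<close>
  define R where "R K = mat_adjoint P * (mat_adjoint K * K) * P" for K
  have RK: "cost (dim_row K) b (kron K (1\<^sub>m b) *\<^sub>v v) = hent (R K)" "psd b (R K)" if "K \<in> set Ks" for K
  proof -
    obtain a' where K': "K \<in> carrier_mat a' a" using K \<open>K \<in> set Ks\<close> by blast
    have KP: "K * P \<in> carrier_mat a' b" using K' P by simp
    have R: "R K = mat_adjoint (K * P) * (K * P)"
      using K' P by (simp add: R_def mat_adjoint_mult[OF K' P] assoc_mult_mat[of _ b a _ a _ b]
          assoc_mult_mat[of _ b a _ a' _ b] assoc_mult_mat[of _ a a' _ a _ b])
    have "cost (dim_row K) b (kron K (1\<^sub>m b) *\<^sub>v v) = hent ((K * P) * mat_adjoint (K * P))"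
      unfolding cost_def using K' coefmat_kron_left[OF K' v] by (simp add: P_def)
    also have "\<dots> = hent (R K)" unfolding R using KP by (intro hent_mult_swap[of _ a' b]) auto
    finally show "cost (dim_row K) b (kron K (1\<^sub>m b) *\<^sub>v v) = hent (R K)" .
    show "psd b (R K)" using psd_gram[of "mat_adjoint (K * P)" b a'] KP by (simp add: R)
  qed
  have dK: "dim_col K = a" if "K \<in> set Ks" for K using K[OF that] by auto
  have "(\<Sum>K\<leftarrow>Ks. cost (dim_row K) b (kron K (1\<^sub>m b) *\<^sub>v v)) = (\<Sum>R\<leftarrow>map R Ks. hent R)"
    using RK(1) by (simp add: o_def cong: map_cong)
  also have "\<dots> \<le> hent (msum b b (map R Ks))"
    using RK(2) by (intro hent_msum) auto
  also have "msum b b (map R Ks) = mat_adjoint P * msum a a (map (\<lambda>K. mat_adjoint K * K) Ks) * P"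
    by (subst msum_conj[of _ a a _ b _ b]) (use P in \<open>auto simp: R_def[abs_def] o_def dK\<close>)
  also have "\<dots> = mat_adjoint P * P" unfolding sum1 using P by simp
  also have "hent \<dots> = cost a b v"
    unfolding cost_def P_def[symmetric] using P by (intro hent_mult_swap[of _ b a]) auto
  finally show ?thesis .
qed

text \<open>The reduced operator of A keeps its size under operations of B, so it is decomposed
  directly, without changing sides. The transposes come from B acting on the coefficient matrix from
  the right.\<close>

lemma cost_local_B:
  assumes v: "v \<in> carrier_vec (a*b)" and K: "\<And>K. K \<in> set Ks \<Longrightarrow> \<exists>b'. K \<in> carrier_mat b' b"
    and sum1: "msum b b (map (\<lambda>K. mat_adjoint K * K) Ks) = 1\<^sub>m b"
  shows "(\<Sum>K\<leftarrow>Ks. cost a (dim_row K) (kron (1\<^sub>m a) K *\<^sub>v v)) \<le> cost a b v"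
proof -
  define P where "P = coefmat a b v"
  have P: "P \<in> carrier_mat a b" by (simp add: P_def)
  define R where "R K = P * transpose_mat (mat_adjoint K * K) * mat_adjoint P" for K
  have RK: "cost a (dim_row K) (kron (1\<^sub>m a) K *\<^sub>v v) = hent (R K)" "psd a (R K)" if "K \<in> set Ks" for K
  proof -
    obtain b' where K': "K \<in> carrier_mat b' b" using K \<open>K \<in> set Ks\<close> by blast
    define T where "T = transpose_mat K"
    have T: "T \<in> carrier_mat b b'" using K' by (simp add: T_def)
    have tr: "transpose_mat (mat_adjoint K * K) = T * mat_adjoint T"
      by (rule eq_matI) (use K' in \<open>auto simp: T_def mat_mult_index mult.commute simp del: index_mult_mat(1)\<close>)
    have R: "R K = (P * T) * mat_adjoint (P * T)"
      using T P by (simp add: R_def tr mat_adjoint_mult[OF P T] assoc_mult_mat[of _ a b _ b _ a]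
          assoc_mult_mat[of _ a b _ b' _ a] assoc_mult_mat[of _ b b' _ b _ a])
    show "cost a (dim_row K) (kron (1\<^sub>m a) K *\<^sub>v v) = hent (R K)"
      unfolding cost_def R using K' coefmat_kron_right[OF K' v] by (simp add: P_def T_def)
    show "psd a (R K)" using psd_gram[of "P * T" a b'] P T by (simp add: R)
  qed
  have dK: "dim_col K = b" if "K \<in> set Ks" for K using K[OF that] by auto
  have "(\<Sum>K\<leftarrow>Ks. cost a (dim_row K) (kron (1\<^sub>m a) K *\<^sub>v v)) = (\<Sum>R\<leftarrow>map R Ks. hent R)"
    using RK(1) by (simp add: o_def cong: map_cong)
  also have "\<dots> \<le> hent (msum a a (map R Ks))"
    using RK(2) by (intro hent_msum) auto
  also have "msum a a (map R Ks) = P * msum b b (map (\<lambda>K. transpose_mat (mat_adjoint K * K)) Ks) * mat_adjoint P"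
    by (subst msum_conj[of _ b b _ a _ a]) (use P in \<open>auto simp: R_def[abs_def] o_def dK\<close>)
  also have "msum b b (map (\<lambda>K. transpose_mat (mat_adjoint K * K)) Ks) =
      transpose_mat (msum b b (map (\<lambda>K. mat_adjoint K * K) Ks))"
    by (rule eq_matI) (auto simp: msum_def dK simp del: index_mult_mat(1) intro!: arg_cong[where f=sum_list] map_cong)
  also have "P * transpose_mat (msum b b (map (\<lambda>K. mat_adjoint K * K) Ks)) * mat_adjoint P = P * mat_adjoint P"
    unfolding sum1 using P by simp
  finally show ?thesis by (simp add: cost_def P_def)
qed

section \<open>Cost of ensembles along a protocol\<close>

definition costs :: "nat \<Rightarrow> nat \<Rightarrow> complex vec list \<Rightarrow> real" where
  "costs a b V = (\<Sum>v\<leftarrow>V. cost a b v)"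

lemma costs_append: "costs a b (V @ W) = costs a b V + costs a b W"
  by (simp add: costs_def)

lemma costs_concat: "costs a b (concat Vs) = (\<Sum>V\<leftarrow>Vs. costs a b V)"
  by (induction Vs) (auto simp: costs_append, simp add: costs_def)

lemma list_all2_concat_map:
  assumes "\<And>x. x \<in> set xs \<Longrightarrow> list_all2 P (f x) (g x)"
  shows "list_all2 P (concat (map f xs)) (concat (map g xs))"
  using assms by (induction xs) (auto intro: list_all2_appendI)

lemma sum_list_swap:
  fixes f :: "'a \<Rightarrow> 'b \<Rightarrow> 'c::comm_monoid_add"
  shows "(\<Sum>x\<leftarrow>xs. \<Sum>y\<leftarrow>ys. f x y) = (\<Sum>y\<leftarrow>ys. \<Sum>x\<leftarrow>xs. f x y)"
  by (induction xs) (auto simp: sum_list_addf)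

lemma sum_list_concat_map:
  fixes f :: "'a \<Rightarrow> 'c::comm_monoid_add"
  shows "(\<Sum>x\<leftarrow>concat xss. f x) = (\<Sum>xs\<leftarrow>xss. \<Sum>x\<leftarrow>xs. f x)"
  by (induction xss) auto

text \<open>The first premise is the inductive hypothesis for the continuations of the protocol after a
  round with Kraus operators \<open>E K\<close> sorted by outcome.\<close>

lemma locc_round:
  assumes IH: "\<And>j V. j < m \<Longrightarrow> set V \<subseteq> carrier_vec (a' j * b' j) \<Longrightarrow> \<exists>Ws.
      list_all2 (\<lambda>M W. set W \<subseteq> carrier_vec d \<and> M (ensemble (a' j * b' j) V) = ensemble d W) (L j) Ws \<and>
      (\<Sum>W\<leftarrow>Ws. c W) \<le> costs (a' j) (b' j) V"
    and V: "set V \<subseteq> carrier_vec n"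
    and E: "\<And>j K. j < m \<Longrightarrow> K \<in> set (Ks j) \<Longrightarrow> E K \<in> carrier_mat (a' j * b' j) n"
    and le: "\<And>v. v \<in> set V \<Longrightarrow> (\<Sum>j\<leftarrow>[0..<m]. \<Sum>K\<leftarrow>Ks j. cost (a' j) (b' j) (E K *\<^sub>v v)) \<le> cost a b v"
  shows "\<exists>Ws. list_all2 (\<lambda>M W. set W \<subseteq> carrier_vec d \<and> M (ensemble n V) = ensemble d W)
      (concat (map (\<lambda>j. map (\<lambda>M. M \<circ> kraus_apply (a' j * b' j) (map E (Ks j))) (L j)) [0..<m])) Ws \<and>
      (\<Sum>W\<leftarrow>Ws. c W) \<le> costs a b V"
proof -
  \<comment> \<open>The ensemble after outcome \<open>j\<close>: Kraus operators that the outcome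
    does not distinguish contribute side by side.\<close>
  define U where "U j = concat (map (\<lambda>K. map (\<lambda>v. E K *\<^sub>v v) V) (Ks j))" for j
  have U: "kraus_apply (a' j * b' j) (map E (Ks j)) (ensemble n V) = ensemble (a' j * b' j) (U j)"
    "set (U j) \<subseteq> carrier_vec (a' j * b' j)" if "j < m" for j
  proof -
    show "kraus_apply (a' j * b' j) (map E (Ks j)) (ensemble n V) = ensemble (a' j * b' j) (U j)"
      using E[OF that] by (subst kraus_apply_ensemble[OF V]) (auto simp: U_def o_def)
    show "set (U j) \<subseteq> carrier_vec (a' j * b' j)" using E[OF that] by (fastforce simp: U_def)
  qed
  have "\<forall>j. \<exists>Ws. j < m \<longrightarrow>
      list_all2 (\<lambda>M W. set W \<subseteq> carrier_vec d \<and> M (ensemble (a' j * b' j) (U j)) = ensemble d W) (L j) Ws \<and>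
      (\<Sum>W\<leftarrow>Ws. c W) \<le> costs (a' j) (b' j) (U j)"
    using IH U(2) by blast
  from choice[OF this] obtain Ws where Ws0: "\<forall>j. j < m \<longrightarrow>
      list_all2 (\<lambda>M W. set W \<subseteq> carrier_vec d \<and> M (ensemble (a' j * b' j) (U j)) = ensemble d W) (L j) (Ws j) \<and>
      (\<Sum>W\<leftarrow>Ws j. c W) \<le> costs (a' j) (b' j) (U j)" ..
  note Ws = Ws0[rule_format, THEN conjunct1] Ws0[rule_format, THEN conjunct2]
  have "list_all2 (\<lambda>M W. set W \<subseteq> carrier_vec d \<and> M (ensemble n V) = ensemble d W)
      (concat (map (\<lambda>j. map (\<lambda>M. M \<circ> kraus_apply (a' j * b' j) (map E (Ks j))) (L j)) [0..<m]))
      (concat (map Ws [0..<m]))"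
    using Ws(1) U(1) by (intro list_all2_concat_map) (auto simp: list_all2_conv_all_nth)
  moreover have "(\<Sum>W\<leftarrow>concat (map Ws [0..<m]). c W) \<le> costs a b V"
  proof -
    have "(\<Sum>W\<leftarrow>concat (map Ws [0..<m]). c W) = (\<Sum>j\<leftarrow>[0..<m]. \<Sum>W\<leftarrow>Ws j. c W)"
      by (simp add: sum_list_concat_map o_def)
    also have "\<dots> \<le> (\<Sum>j\<leftarrow>[0..<m]. costs (a' j) (b' j) (U j))"
      using Ws(2) by (intro sum_list_mono) auto
    also have "\<dots> = (\<Sum>j\<leftarrow>[0..<m]. \<Sum>K\<leftarrow>Ks j. \<Sum>v\<leftarrow>V. cost (a' j) (b' j) (E K *\<^sub>v v))"
      by (simp add: U_def costs_concat o_def) (simp add: costs_def o_def)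
    also have "\<dots> = (\<Sum>v\<leftarrow>V. \<Sum>j\<leftarrow>[0..<m]. \<Sum>K\<leftarrow>Ks j. cost (a' j) (b' j) (E K *\<^sub>v v))"
    proof -
      have "(\<Sum>K\<leftarrow>Ks j. \<Sum>v\<leftarrow>V. cost (a' j) (b' j) (E K *\<^sub>v v)) =
          (\<Sum>v\<leftarrow>V. \<Sum>K\<leftarrow>Ks j. cost (a' j) (b' j) (E K *\<^sub>v v))" for j by (rule sum_list_swap)
      then show ?thesis by (simp only:) (rule sum_list_swap)
    qed
    also have "\<dots> \<le> costs a b V"
      unfolding costs_def using le by (intro sum_list_mono) auto
    finally show ?thesis .
  qed
  ultimately show ?thesis by blast
qed

text \<open>With \<open>V\<close> arbitrary and unnormalised, the induction hypothesis applies to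
  each branch whatever its probability and its local dimensions.\<close>

lemma locc_ensemble:
  assumes "locc a b a' b' Ms" "set V \<subseteq> carrier_vec (a*b)"
  shows "\<exists>Ws. list_all2 (\<lambda>M W. set W \<subseteq> carrier_vec (a'*b') \<and> M (ensemble (a*b) V) = ensemble (a'*b') W) Ms Ws \<and>
     (\<Sum>W\<leftarrow>Ws. costs a' b' W) \<le> costs a b V"
  using assms
proof (induction arbitrary: V rule: locc.induct)
  case (locc_id a b)
  then show ?case by (intro exI[of _ "[V]"]) auto
next
  case (locc_A m Ks a' a b a'' b'' L)
  show ?case
  proof (rule locc_round[where b' = "\<lambda>_. b" and E = "\<lambda>K. kron K (1\<^sub>m b)"])
    show "set V \<subseteq> carrier_vec (a*b)" by fact
    show "kron K (1\<^sub>m b) \<in> carrier_mat (a' j * b) (a * b)" if "j < m" "K \<in> set (Ks j)" for j K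
      using locc_A(1) that by (intro kron_carrier) auto
    fix v assume "v \<in> set V"
    then have v: "v \<in> carrier_vec (a*b)" using locc_A.prems by auto
    have dK: "dim_row K = a' j" if "j \<in> set [0..<m]" "K \<in> set (Ks j)" for j K
      using locc_A(1) that by (auto intro!: carrier_matD(1))
    have "(\<Sum>j\<leftarrow>[0..<m]. \<Sum>K\<leftarrow>Ks j. cost (a' j) b (kron K (1\<^sub>m b) *\<^sub>v v)) =
        (\<Sum>j\<leftarrow>[0..<m]. \<Sum>K\<leftarrow>Ks j. cost (dim_row K) b (kron K (1\<^sub>m b) *\<^sub>v v))"
      using dK by (intro arg_cong[where f=sum_list] map_cong refl) simp
    also have "\<dots> = (\<Sum>K\<leftarrow>concat (map Ks [0..<m]). cost (dim_row K) b (kron K (1\<^sub>m b) *\<^sub>v v))"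
      by (simp add: sum_list_concat_map o_def)
    also have "\<dots> \<le> cost a b v"
      using locc_A(1,2) v by (intro cost_local_A) (fastforce simp: map_concat o_def)+
    finally show "(\<Sum>j\<leftarrow>[0..<m]. \<Sum>K\<leftarrow>Ks j. cost (a' j) b (kron K (1\<^sub>m b) *\<^sub>v v)) \<le> cost a b v" .
  qed (use locc_A(3) in blast)
next
  case (locc_B m Ks b' b a a'' b'' L)
  show ?case
  proof (rule locc_round[where a' = "\<lambda>_. a" and E = "\<lambda>K. kron (1\<^sub>m a) K"])
    show "set V \<subseteq> carrier_vec (a*b)" by fact
    show "kron (1\<^sub>m a) K \<in> carrier_mat (a * b' j) (a * b)" if "j < m" "K \<in> set (Ks j)" for j K
      using locc_B(1) that by (intro kron_carrier) auto
    fix v assume "v \<in> set V"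
    then have v: "v \<in> carrier_vec (a*b)" using locc_B.prems by auto
    have dK: "dim_row K = b' j" if "j \<in> set [0..<m]" "K \<in> set (Ks j)" for j K
      using locc_B(1) that by (auto intro!: carrier_matD(1))
    have "(\<Sum>j\<leftarrow>[0..<m]. \<Sum>K\<leftarrow>Ks j. cost a (b' j) (kron (1\<^sub>m a) K *\<^sub>v v)) =
        (\<Sum>j\<leftarrow>[0..<m]. \<Sum>K\<leftarrow>Ks j. cost a (dim_row K) (kron (1\<^sub>m a) K *\<^sub>v v))"
      using dK by (intro arg_cong[where f=sum_list] map_cong refl) simp
    also have "\<dots> = (\<Sum>K\<leftarrow>concat (map Ks [0..<m]). cost a (dim_row K) (kron (1\<^sub>m a) K *\<^sub>v v))"
      by (simp add: sum_list_concat_map o_def)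
    also have "\<dots> \<le> cost a b v"
      using locc_B(1,2) v by (intro cost_local_B) (fastforce simp: map_concat o_def)+
    finally show "(\<Sum>j\<leftarrow>[0..<m]. \<Sum>K\<leftarrow>Ks j. cost a (b' j) (kron (1\<^sub>m a) K *\<^sub>v v)) \<le> cost a b v" .
  qed (use locc_B(3) in blast)
next
  case (locc_coarse a b a' b' Ms f k)
  then obtain Ws where Ws:
    "list_all2 (\<lambda>M W. set W \<subseteq> carrier_vec (a'*b') \<and> M (ensemble (a*b) V) = ensemble (a'*b') W) Ms Ws"
    "(\<Sum>W\<leftarrow>Ws. costs a' b' W) \<le> costs a b V" by blast
  have len: "length Ws = length Ms" using Ws(1) by (simp add: list_all2_lengthD)
  have nth: "set (Ws ! i) \<subseteq> carrier_vec (a'*b')" "(Ms ! i) (ensemble (a*b) V) = ensemble (a'*b') (Ws ! i)"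
    if "i < length Ms" for i
    using Ws(1) that by (auto simp: list_all2_conv_all_nth)
  define I where "I j = filter (\<lambda>i. f i = j) [0..<length Ms]" for j
  define W' where "W' j = concat (map (\<lambda>i. Ws ! i) (I j))" for j
  have "set (W' j) \<subseteq> carrier_vec (a'*b')" for j
    using nth(1) by (fastforce simp: W'_def I_def)
  moreover have "msum (a'*b') (a'*b') (map (\<lambda>i. (Ms ! i) (ensemble (a*b) V)) (I j)) = ensemble (a'*b') (W' j)" for j
    unfolding W'_def ensemble_concat map_map
    using nth(2) by (intro arg_cong[where f="msum (a'*b') (a'*b')"] map_cong) (auto simp: I_def)
  moreover have "(\<Sum>j\<leftarrow>[0..<k]. costs a' b' (W' j)) = (\<Sum>W\<leftarrow>Ws. costs a' b' W)"
  proof -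
    have "(\<Sum>j\<leftarrow>[0..<k]. costs a' b' (W' j)) = (\<Sum>j<k. \<Sum>i\<leftarrow>I j. costs a' b' (Ws ! i))"
      by (simp add: W'_def costs_concat o_def interv_sum_list_conv_sum_set_nat lessThan_atLeast0)
    also have "\<dots> = (\<Sum>j<k. \<Sum>i\<in>{i. i < length Ms \<and> f i = j}. costs a' b' (Ws ! i))"
    proof (intro sum.cong refl)
      fix j
      have "(\<Sum>i\<leftarrow>I j. costs a' b' (Ws ! i)) = (\<Sum>i\<in>set (I j). costs a' b' (Ws ! i))"
        by (rule sum_list_distinct_conv_sum_set) (simp add: I_def)
      also have "set (I j) = {i. i < length Ms \<and> f i = j}" by (auto simp: I_def)
      finally show "(\<Sum>i\<leftarrow>I j. costs a' b' (Ws ! i)) = (\<Sum>i\<in>{i. i < length Ms \<and> f i = j}. costs a' b' (Ws ! i))" .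
    qed
    \<comment> \<open>Since \<open>f\<close> takes its values below \<open>k\<close>, its fibres
      partition the outcomes: merging neither loses nor repeats an ensemble.\<close>
    also have "\<dots> = (\<Sum>i<length Ms. costs a' b' (Ws ! i))"
      using sum.group[of "{..<length Ms}" "{..<k}" f "\<lambda>i. costs a' b' (Ws ! i)"] locc_coarse.hyps(2) by auto
    also have "\<dots> = (\<Sum>W\<leftarrow>Ws. costs a' b' W)"
      by (simp add: sum_list_sum_nth len lessThan_atLeast0)
    finally show ?thesis .
  qed
  ultimately show ?case using Ws(2)
    by (intro exI[of _ "map W' [0..<k]"]) (auto simp: list_all2_conv_all_nth o_def I_def[symmetric])
qed

section \<open>Entanglement as an infimum over ensembles\<close>

lemma rnorm_pos:
  assumes "2 \<le> d"
  shows "0 < rnorm d"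
proof -
  have l: "0 < log 2 (real d)" "log 2 (real d - 1) \<le> log 2 (real d)" using assms by auto
  have "(real d - 1) * log 2 (real d - 1) \<le> (real d - 1) * log 2 (real d)"
    using l assms by (intro mult_left_mono) auto
  also have "\<dots> < real d * log 2 (real d)" using l by simp
  finally show ?thesis by (simp add: rnorm_def)
qed

text \<open>At \<open>d = 1\<close> both terms vanish, so \<open>rnorm 1 = 0\<close>, and division
  by it gives 0.\<close>

lemma rnorm_nonneg: "0 < d \<Longrightarrow> 0 \<le> rnorm d"
proof (cases "d = 1")
  case False
  assume "0 < d"
  with False have "2 \<le> d" by simp
  then show ?thesis using rnorm_pos by (simp add: less_imp_le)
qed (simp add: rnorm_def)

definition Et_values :: "nat \<Rightarrow> nat \<Rightarrow> complex mat \<Rightarrow> real set" where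
  "Et_values a b \<rho> = {(\<Sum>i<n. p i * Et_pure a b (\<phi> i)) | n p \<phi>.
      (\<forall>i<n. 0 \<le> p i \<and> unit_vec (a*b) (\<phi> i)) \<and> (\<Sum>i<n. p i) = 1 \<and>
      \<rho> = msum (a*b) (a*b) (map (\<lambda>i. of_real (p i) \<cdot>\<^sub>m proj (\<phi> i)) [0..<n])}"

lemma Et_eq_Inf_values: "Et a b \<rho> = Inf (Et_values a b \<rho>)"
  by (simp add: Et_def Et_values_def)

lemma Et_values_ensemble:
  assumes "x \<in> Et_values a b \<rho>"
  obtains V where "set V \<subseteq> carrier_vec (a*b)" "\<rho> = ensemble (a*b) V" "x = costs a b V / rnorm a"
proof -
  from assms obtain n p \<phi> where x: "x = (\<Sum>i<n. p i * Et_pure a b (\<phi> i))"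
    and p: "\<And>i. i < n \<Longrightarrow> 0 \<le> p i" and \<phi>: "\<And>i. i < n \<Longrightarrow> unit_vec (a*b) (\<phi> i)"
    and \<rho>: "\<rho> = msum (a*b) (a*b) (map (\<lambda>i. of_real (p i) \<cdot>\<^sub>m proj (\<phi> i)) [0..<n])"
    by (auto simp: Et_values_def)
  define V where "V = map (\<lambda>i. of_real (sqrt (p i)) \<cdot>\<^sub>v \<phi> i) [0..<n]"
  have \<phi>c: "\<phi> i \<in> carrier_vec (a*b)" if "i < n" for i using \<phi>[OF that] by (simp add: unit_vec_def)
  have V: "set V \<subseteq> carrier_vec (a*b)" using \<phi>c by (auto simp: V_def)
  moreover have "\<rho> = ensemble (a*b) V"
    unfolding \<rho> ensemble_def V_def map_map using p
    by (intro arg_cong[where f="msum (a*b) (a*b)"] map_cong refl) (auto simp: proj_smult)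
  moreover have "x = costs a b V / rnorm a"
  proof -
    have "costs a b V = (\<Sum>i<n. p i * cost a b (\<phi> i))"
      unfolding costs_def V_def map_map using p \<phi>c
      by (simp add: interv_sum_list_conv_sum_set_nat lessThan_atLeast0 cost_smult)
    moreover have "p i * Et_pure a b (\<phi> i) = p i * cost a b (\<phi> i) / rnorm a" if "i < n" for i
      using Et_pure_unit[OF \<phi>[OF that]] by simp
    ultimately show ?thesis by (simp add: x sum_divide_distrib)
  qed
  ultimately show ?thesis by (rule that)
qed

text \<open>A vector of squared norm p stands for its direction taken with probability p; the trace
  condition makes these probabilities sum to 1.\<close>

lemma ensemble_in_Et_values:
  assumes V: "set V \<subseteq> carrier_vec (a*b)" and tr: "trace (ensemble (a*b) V) = 1"
  shows "costs a b V / rnorm a \<in> Et_values a b (ensemble (a*b) V)"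
proof -
  define s where "s v = (\<Sum>i<dim_vec v. (cmod (v $ i))^2)" for v :: "complex vec"
  have cs: "cinner v v = of_real (s v)" for v by (simp add: cinner_self s_def)
  have s0: "0 \<le> s v" for v by (auto simp: s_def intro: sum_nonneg)
  \<comment> \<open>A zero vector has no direction. It contributes neither to the operator nor to
    the cost and is dropped.\<close>
  define V' where "V' = filter (\<lambda>v. s v \<noteq> 0) V"
  have V': "set V' \<subseteq> carrier_vec (a*b)" "\<And>v. v \<in> set V' \<Longrightarrow> s v > 0"
    using V s0 by (auto simp: V'_def less_le)
  have zero: "v = 0 \<cdot>\<^sub>v v" if "s v = 0" for v
  proof (rule eq_vecI)
    fix i assume "i < dim_vec (0 \<cdot>\<^sub>v v)"
    then show "v $ i = (0 \<cdot>\<^sub>v v) $ i"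
      using that by (simp add: s_def sum_nonneg_eq_0_iff)
  qed simp
  have V'eq: "ensemble (a*b) V = ensemble (a*b) V' \<and> costs a b V = costs a b V'"
    using V unfolding V'_def
  proof (induction V)
    case (Cons v V)
    have "proj v = 0\<^sub>m (a*b) (a*b)" "cost a b v = 0" if "s v = 0"
    proof -
      have v: "v \<in> carrier_vec (a*b)" using Cons.prems by simp
      show "proj v = 0\<^sub>m (a*b) (a*b)"
        using v by (subst zero[OF that], subst proj_smult) (auto simp: proj_def intro!: eq_matI)
      show "cost a b v = 0"
        by (subst zero[OF that], subst cost_smult[OF v]) simp
    qed
    then show ?case using Cons by (simp add: ensemble_Cons) (simp add: costs_def)
  qed simp
  define n where "n = length V'"
  define p where "p i = s (V' ! i)" for i
  define \<phi> where "\<phi> i = of_real (1 / sqrt (p i)) \<cdot>\<^sub>v V' ! i" for i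
  have mem: "V' ! i \<in> carrier_vec (a*b)" "p i > 0" if "i < n" for i
    using V' that by (auto simp: n_def p_def)
  have pos: "0 \<le> p i" if "i < n" for i using mem[OF that] by simp
  have unit: "unit_vec (a*b) (\<phi> i)" if "i < n" for i
  proof -
    have "cinner (\<phi> i) (\<phi> i) = trace (proj (\<phi> i))" by (simp add: trace_proj)
    also have "\<dots> = of_real (1 / p i) * cinner (V' ! i) (V' ! i)"
      using mem[OF that]
      by (simp add: \<phi>_def proj_smult trace_smult[OF proj_carrier[OF mem(1)[OF that]]] trace_proj power_divide norm_divide
          del: of_real_power of_real_divide)
    also have "\<dots> = 1" using mem[OF that] by (simp add: cs p_def)
    finally show ?thesis using mem[OF that] by (simp add: unit_vec_def \<phi>_def)
  qed
  have \<phi>V: "of_real (p i) \<cdot>\<^sub>m proj (\<phi> i) = proj (V' ! i)" if "i < n" for i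
    using mem[OF that] by (intro eq_matI) (auto simp: \<phi>_def proj_smult norm_divide power_divide)
  have c\<phi>: "p i * cost a b (\<phi> i) = cost a b (V' ! i)" if "i < n" for i
    using mem[OF that] by (simp add: \<phi>_def cost_smult norm_divide power_divide del: of_real_divide)
  have "ensemble (a*b) V = msum (a*b) (a*b) (map (\<lambda>i. of_real (p i) \<cdot>\<^sub>m proj (\<phi> i)) [0..<n])"
  proof -
    have "map (\<lambda>i. of_real (p i) \<cdot>\<^sub>m proj (\<phi> i)) [0..<n] = map proj V'"
      using \<phi>V by (intro nth_equalityI) (auto simp: n_def)
    then show ?thesis using V'eq by (simp add: ensemble_def)
  qed
  moreover have "(\<Sum>i<n. p i) = 1"
  proof -
    have "of_real (\<Sum>i<n. p i) = (\<Sum>v\<leftarrow>V'. cinner v v)"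
      by (simp add: cs sum_list_sum_nth n_def p_def lessThan_atLeast0)
    also have "\<dots> = 1" using tr V'eq trace_ensemble[OF V'(1)] by simp
    finally show ?thesis by (metis of_real_eq_1_iff)
  qed
  moreover have "costs a b V / rnorm a = (\<Sum>i<n. p i * Et_pure a b (\<phi> i))"
  proof -
    have "costs a b V = (\<Sum>i<n. cost a b (V' ! i))"
      using V'eq by (simp add: costs_def sum_list_sum_nth n_def lessThan_atLeast0)
    also have "\<dots> / rnorm a = (\<Sum>i<n. p i * Et_pure a b (\<phi> i))"
      unfolding sum_divide_distrib
      by (intro sum.cong refl) (use c\<phi> Et_pure_unit[OF unit] in auto)
    finally show ?thesis .
  qed
  ultimately show ?thesis using pos unit unfolding Et_values_def by blast
qed

text \<open>The spectral decomposition, with each eigenvector scaled by the square root of its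
  eigenvalue.\<close>

lemma psd_ensemble:
  assumes "psd n R"
  obtains V where "set V \<subseteq> carrier_vec n" "R = ensemble n V"
proof -
  obtain U d where U: "unitary n U" and R: "R = U * dmat n d * mat_adjoint U"
    and d: "\<And>k. k < n \<Longrightarrow> 0 \<le> d k"
    using psd_spectral[OF assms] by metis
  note U' = unitaryD[OF U]
  define V where "V = map (\<lambda>k. of_real (sqrt (d k)) \<cdot>\<^sub>v col U k) [0..<n]"
  have V: "set V \<subseteq> carrier_vec n" using U'(1) by (auto simp: V_def intro!: carrier_vecI)
  have "R = ensemble n V"
  proof (rule eq_matI)
    fix i j assume "i < dim_row (ensemble n V)" "j < dim_col (ensemble n V)"
    then have ij: "i < n" "j < n" by auto
    have "(U * dmat n d) $$ (i,k) = U $$ (i,k) * of_real (d k)" if "k < n" for k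
      using ij U'(1) that by (simp add: mat_mult_index dmat_def if_distrib[where f="\<lambda>y. _ * y"]
          del: index_mult_mat(1) cong: if_cong)
    then have "R $$ (i,j) = (\<Sum>k<n. U $$ (i,k) * of_real (d k) * cnj (U $$ (j,k)))"
      using ij U'(1) by (simp add: R mat_mult_index[of i "U * dmat n d"] del: index_mult_mat(1))
    also have "\<dots> = ensemble n V $$ (i,j)"
    proof -
      have "proj (of_real (sqrt (d k)) \<cdot>\<^sub>v col U k) $$ (i,j) = U $$ (i,k) * of_real (d k) * cnj (U $$ (j,k))"
        if "k < n" for k
        using ij U'(1) d[OF that] that unfolding proj_smult by (simp add: proj_def)
      then show ?thesis using ij
        by (simp add: ensemble_def V_def msum_def o_def interv_sum_list_conv_sum_set_nat lessThan_atLeast0)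
    qed
    finally show "R $$ (i,j) = ensemble n V $$ (i,j)" .
  qed (use U' in \<open>auto simp: R\<close>)
  with V show ?thesis by (rule that)
qed

text \<open>The spectral ensemble is a member. Together with nonnegativity this makes the real
  infimum in \<open>Et\<close> meaningful.\<close>

lemma Et_values_nonempty:
  assumes "density_op (a*b) \<rho>"
  shows "Et_values a b \<rho> \<noteq> {}"
  using assms psd_ensemble[of "a*b" \<rho>] ensemble_in_Et_values unfolding density_op_iff_psd by (metis empty_iff)

lemma density_op_dim_pos:
  assumes "density_op n \<rho>"
  shows "0 < n"
  using assms by (cases n) (auto simp: density_op_def trace_def)

lemma costs_nonneg: "0 \<le> costs a b V"
  by (auto simp: costs_def intro!: sum_list_nonneg cost_nonneg)

lemma Et_values_nonneg:
  assumes "0 < a" "x \<in> Et_values a b \<rho>"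
  shows "0 \<le> x"
  using assms rnorm_nonneg costs_nonneg by (metis Et_values_ensemble divide_nonneg_nonneg)

lemma Et_le_ensemble:
  assumes "0 < a" "set V \<subseteq> carrier_vec (a*b)" "trace (ensemble (a*b) V) = 1"
  shows "Et a b (ensemble (a*b) V) \<le> costs a b V / rnorm a"
  unfolding Et_eq_Inf_values
  using assms Et_values_nonneg by (intro cInf_lower ensemble_in_Et_values bdd_belowI) auto

lemma Et_nonneg:
  assumes "density_op (a*b) \<rho>"
  shows "0 \<le> Et a b \<rho>"
  unfolding Et_eq_Inf_values
  using Et_values_nonempty[OF assms] density_op_dim_pos[OF assms] Et_values_nonneg
  by (intro cInf_greatest) auto

lemma Et_approx:
  assumes "density_op (a*b) \<rho>" "0 < \<epsilon>"
  obtains V where "set V \<subseteq> carrier_vec (a*b)" "\<rho> = ensemble (a*b) V" "costs a b V / rnorm a < Et a b \<rho> + \<epsilon>"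
proof -
  obtain x where "x \<in> Et_values a b \<rho>" "x < Et a b \<rho> + \<epsilon>"
    using cInf_lessD[OF Et_values_nonempty[OF assms(1)], of "Et a b \<rho> + \<epsilon>"] assms(2)
    by (auto simp: Et_eq_Inf_values)
  then show ?thesis using that by (metis Et_values_ensemble)
qed

lemma Et_locc_monotone:
  assumes \<rho>: "density_op (a*b) \<rho>" and M: "locc a b a b Ms"
  shows "(\<Sum>j<length Ms. Re (trace ((Ms ! j) \<rho>)) * Et a b ((1 / trace ((Ms ! j) \<rho>)) \<cdot>\<^sub>m (Ms ! j) \<rho>)) \<le> Et a b \<rho>"
proof (rule field_le_epsilon)
  fix \<epsilon> :: real assume "0 < \<epsilon>"
  then obtain V where V: "set V \<subseteq> carrier_vec (a*b)" "\<rho> = ensemble (a*b) V" "costs a b V / rnorm a < Et a b \<rho> + \<epsilon>"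
    using Et_approx[OF \<rho>] by blast
  have a: "0 < a" using density_op_dim_pos[OF \<rho>] by simp
  obtain Ws where Ws: "list_all2 (\<lambda>M W. set W \<subseteq> carrier_vec (a*b) \<and> M \<rho> = ensemble (a*b) W) Ms Ws"
    "(\<Sum>W\<leftarrow>Ws. costs a b W) \<le> costs a b V"
    using locc_ensemble[OF M V(1)] unfolding V(2)[symmetric] by blast
  have len: "length Ws = length Ms" using Ws(1) by (simp add: list_all2_lengthD)
  have le: "Re (trace ((Ms ! j) \<rho>)) * Et a b ((1 / trace ((Ms ! j) \<rho>)) \<cdot>\<^sub>m (Ms ! j) \<rho>) \<le> costs a b (Ws ! j) / rnorm a"
    if j: "j < length Ms" for j
  proof -
    define W where "W = Ws ! j"
    have W: "set W \<subseteq> carrier_vec (a*b)" "(Ms ! j) \<rho> = ensemble (a*b) W"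
      using Ws(1) j by (auto simp: list_all2_conv_all_nth W_def)
    define q where "q = (\<Sum>w\<leftarrow>W. \<Sum>i<dim_vec w. (cmod (w $ i))^2)"
    have q: "trace (ensemble (a*b) W) = of_real q"
      unfolding trace_ensemble[OF W(1)] q_def cinner_self by (induction W) auto
    have q0: "q \<ge> 0" by (auto simp: q_def intro!: sum_list_nonneg sum_nonneg)
    show ?thesis
    \<comment> \<open>An outcome of probability 0 contributes 0 through its prefactor, whatever
      \<open>Et\<close> is at the matrix written in place of its state.\<close>
    proof (cases "q = 0")
      case True
      then show ?thesis using costs_nonneg[of a b W] rnorm_nonneg[OF a] by (simp add: W(2) q W_def[symmetric])
    next
      case False
      with q0 have qp: "q > 0" by simp
      \<comment> \<open>Renormalising divides both the operator and the cost by \<open>q\<close>,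
        which the probability in front cancels again.\<close>
      define W' where "W' = map (\<lambda>w. of_real (1 / sqrt q) \<cdot>\<^sub>v w) W"
      have W': "set W' \<subseteq> carrier_vec (a*b)" using W(1) by (auto simp: W'_def)
      have c2: "(cmod (of_real (1 / sqrt q)))^2 = 1 / q" using qp by (simp add: norm_divide power_divide)
      have e: "ensemble (a*b) W' = (1 / trace ((Ms ! j) \<rho>)) \<cdot>\<^sub>m (Ms ! j) \<rho>"
        unfolding W'_def ensemble_smult[OF W(1)] c2 W(2) q by simp
      have "trace (ensemble (a*b) W') = 1"
        unfolding e W(2) trace_smult[OF ensemble_carrier] q using qp by simp
      from Et_le_ensemble[OF a W' this]
      have "Et a b ((1 / trace ((Ms ! j) \<rho>)) \<cdot>\<^sub>m (Ms ! j) \<rho>) \<le> costs a b W' / rnorm a" by (simp add: e)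
      also have "costs a b W' = costs a b W / q"
      proof -
        have "costs a b W' = (\<Sum>w\<leftarrow>W. inverse q * cost a b w)"
          unfolding costs_def W'_def map_map using W(1) c2
          by (intro arg_cong[where f=sum_list] map_cong refl) (auto simp: cost_smult divide_inverse simp del: of_real_divide)
        then show ?thesis by (simp add: sum_list_const_mult costs_def divide_inverse mult.commute)
      qed
      finally have "q * Et a b ((1 / trace ((Ms ! j) \<rho>)) \<cdot>\<^sub>m (Ms ! j) \<rho>) \<le> q * (costs a b W / q / rnorm a)"
        using qp by (intro mult_left_mono) auto
      then show ?thesis using qp by (simp add: W(2) q W_def[symmetric])
    qed
  qed
  have "(\<Sum>j<length Ms. Re (trace ((Ms ! j) \<rho>)) * Et a b ((1 / trace ((Ms ! j) \<rho>)) \<cdot>\<^sub>m (Ms ! j) \<rho>))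
      \<le> (\<Sum>j<length Ms. costs a b (Ws ! j) / rnorm a)"
    using le by (intro sum_mono) auto
  also have "\<dots> = (\<Sum>W\<leftarrow>Ws. costs a b W) / rnorm a"
    by (simp add: sum_list_sum_nth len lessThan_atLeast0 sum_divide_distrib)
  also have "\<dots> \<le> costs a b V / rnorm a"
    using Ws(2) rnorm_nonneg[OF a] by (intro divide_right_mono)
  finally show "(\<Sum>j<length Ms. Re (trace ((Ms ! j) \<rho>)) * Et a b ((1 / trace ((Ms ! j) \<rho>)) \<cdot>\<^sub>m (Ms ! j) \<rho>))
      \<le> Et a b \<rho> + \<epsilon>" using V(3) by linarith
qed

lemma trace_msum:
  assumes "\<And>M. M \<in> set Ms \<Longrightarrow> M \<in> carrier_mat n n"
  shows "trace (msum n n Ms) = (\<Sum>M\<leftarrow>Ms. trace M)"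
  using assms by (induction Ms) (auto simp: msum_Cons trace_add[of _ n], simp add: trace_def)

text \<open>Near-optimal ensembles of the single states, scaled by sqrt(p_i) and concatenated,
  compete in the infimum for the mixture. The same error serves all indices because the weights sum
  to 1.\<close>

lemma Et_convex:
  assumes p: "\<And>i. i < n \<Longrightarrow> 0 \<le> p i" and \<rho>: "\<And>i. i < n \<Longrightarrow> density_op (a*b) (\<rho>s i)" and sum1: "(\<Sum>i<n. p i) = 1"
  shows "Et a b (msum (a*b) (a*b) (map (\<lambda>i. of_real (p i) \<cdot>\<^sub>m \<rho>s i) [0..<n])) \<le> (\<Sum>i<n. p i * Et a b (\<rho>s i))"
proof (rule field_le_epsilon)
  fix \<epsilon> :: real assume \<epsilon>: "0 < \<epsilon>"
  have n: "0 < n" using sum1 by (cases n) auto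
  have a: "0 < a" using density_op_dim_pos[OF \<rho>[OF n]] by simp
  have "\<forall>i. \<exists>V. i < n \<longrightarrow> set V \<subseteq> carrier_vec (a*b) \<and> \<rho>s i = ensemble (a*b) V \<and>
      costs a b V / rnorm a < Et a b (\<rho>s i) + \<epsilon>"
    using Et_approx[OF \<rho> \<epsilon>] by metis
  from choice[OF this] obtain V where V0: "\<forall>i. i < n \<longrightarrow> set (V i) \<subseteq> carrier_vec (a*b) \<and> \<rho>s i = ensemble (a*b) (V i) \<and>
      costs a b (V i) / rnorm a < Et a b (\<rho>s i) + \<epsilon>" ..
  then have V: "set (V i) \<subseteq> carrier_vec (a*b)" "\<rho>s i = ensemble (a*b) (V i)"
      "costs a b (V i) / rnorm a < Et a b (\<rho>s i) + \<epsilon>" if "i < n" for i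
    using that by auto
  define U where "U i = map (\<lambda>v. of_real (sqrt (p i)) \<cdot>\<^sub>v v) (V i)" for i
  have U: "set (U i) \<subseteq> carrier_vec (a*b)" "ensemble (a*b) (U i) = of_real (p i) \<cdot>\<^sub>m \<rho>s i"
    "costs a b (U i) = p i * costs a b (V i)" if "i < n" for i
  proof -
    show "set (U i) \<subseteq> carrier_vec (a*b)" using V(1)[OF that] by (auto simp: U_def)
    show "ensemble (a*b) (U i) = of_real (p i) \<cdot>\<^sub>m \<rho>s i"
      unfolding U_def ensemble_smult[OF V(1)[OF that]] using p[OF that] V(2)[OF that] by simp
    have "costs a b (U i) = (\<Sum>v\<leftarrow>V i. p i * cost a b v)"
      unfolding costs_def U_def map_map using V(1)[OF that] p[OF that]
      by (intro arg_cong[where f=sum_list] map_cong refl) (auto simp: cost_smult)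
    then show "costs a b (U i) = p i * costs a b (V i)" by (simp add: sum_list_const_mult costs_def)
  qed
  define W where "W = concat (map U [0..<n])"
  have W: "set W \<subseteq> carrier_vec (a*b)" using U(1) by (fastforce simp: W_def)
  have e: "msum (a*b) (a*b) (map (\<lambda>i. of_real (p i) \<cdot>\<^sub>m \<rho>s i) [0..<n]) = ensemble (a*b) W"
    unfolding W_def ensemble_concat map_map
    using U(2) by (intro arg_cong[where f="msum (a*b) (a*b)"] map_cong refl) auto
  have "trace (ensemble (a*b) W) = 1"
  proof -
    have c: "\<rho>s i \<in> carrier_mat (a*b) (a*b)" "trace (\<rho>s i) = 1" if "i < n" for i
      using \<rho>[OF that] by (auto simp: density_op_def)
    have "trace (ensemble (a*b) W) = (\<Sum>i\<leftarrow>[0..<n]. trace (of_real (p i) \<cdot>\<^sub>m \<rho>s i))"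
      unfolding e[symmetric] by (subst trace_msum) (use c in \<open>auto simp: o_def\<close>)
    also have "\<dots> = (\<Sum>i<n. of_real (p i))"
      using c by (simp add: interv_sum_list_conv_sum_set_nat lessThan_atLeast0 trace_smult[of _ "a*b"])
    also have "\<dots> = 1" using sum1 by (metis of_real_1 of_real_sum)
    finally show ?thesis .
  qed
  from Et_le_ensemble[OF a W this]
  have "Et a b (ensemble (a*b) W) \<le> costs a b W / rnorm a" .
  also have "costs a b W = (\<Sum>i<n. p i * costs a b (V i))"
    using U(3) by (simp add: W_def costs_concat o_def interv_sum_list_conv_sum_set_nat lessThan_atLeast0)
  also have "\<dots> / rnorm a = (\<Sum>i<n. p i * (costs a b (V i) / rnorm a))"
    by (simp add: sum_divide_distrib)
  also have "\<dots> \<le> (\<Sum>i<n. p i * (Et a b (\<rho>s i) + \<epsilon>))"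
    using p V(3) by (intro sum_mono mult_left_mono) (auto intro: less_imp_le)
  also have "\<dots> = (\<Sum>i<n. p i * Et a b (\<rho>s i)) + \<epsilon>"
    using sum1 by (simp add: distrib_left sum.distrib sum_distrib_right[symmetric])
  finally show "Et a b (msum (a*b) (a*b) (map (\<lambda>i. of_real (p i) \<cdot>\<^sub>m \<rho>s i) [0..<n])) \<le> (\<Sum>i<n. p i * Et a b (\<rho>s i)) + \<epsilon>"
    unfolding e .
qed

section \<open>Product vectors and separability\<close>

text \<open>All minors of order two vanish, that is, the coefficient matrix has rank at most 1.
  Unlike the existence of factors, this is a system of polynomial equations and passes to limits at
  once.\<close>

definition product_vec :: "nat \<Rightarrow> nat \<Rightarrow> complex vec \<Rightarrow> bool" where
  "product_vec a b v \<longleftrightarrow> (\<forall>i<a. \<forall>j<a. \<forall>k<b. \<forall>l<b.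
     v $ (i*b + k) * v $ (j*b + l) = v $ (i*b + l) * v $ (j*b + k))"

lemma cmod_diff_square:
  "(cmod (x - y))^2 = (cmod x)^2 + (cmod y)^2 - 2 * Re (x * cnj y)"
  unfolding cmod_power2 by (simp add: power2_eq_square algebra_simps)

text \<open>The squared moduli of all minors of order two sum to twice the linear entropy.\<close>

lemma minor_le_cost:
  assumes v: "v \<in> carrier_vec (a*b)" and ij: "i < a" "j < a" "k < b" "l < b"
  shows "(cmod (v $ (i*b + k) * v $ (j*b + l) - v $ (i*b + l) * v $ (j*b + k)))^2
    \<le> 2 * (Re (cinner v v) * cost a b v)"
proof -
  define P where "P i k = v $ (i*b + k)" for i k
  define C where "C = coefmat a b v"
  define R where "R = C * mat_adjoint C"
  have Rc: "R \<in> carrier_mat a a" and psd: "psd a R" by (auto simp: R_def C_def intro!: psd_gram)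
  have Rij: "R $$ (i,j) = (\<Sum>k<b. P i k * cnj (P j k))" if "i < a" "j < a" for i j
    using that by (simp add: R_def C_def mat_mult_index P_def del: index_mult_mat(1))
  define S where "S = (\<Sum>i<a. \<Sum>k<b. (cmod (P i k))^2)"
  have trS: "trace R = of_real S"
    using trace_gram_coefmat[OF v] v
    by (simp add: R_def C_def cinner_self sum_product_index P_def S_def)
  define M where "M i j k l = (cmod (P i k * P j l - P i l * P j k))^2" for i j k l
  \<comment> \<open>The cross term is grouped so that summing over \<open>k\<close> and
    \<open>l\<close> gives R_ij R_ji, hence the trace of R^2 in total. Each of the two squares sums
    to S^2, which explains the factor 2 below.\<close>
  have exp: "M i j k l = (cmod (P i k))^2 * (cmod (P j l))^2 + (cmod (P i l))^2 * (cmod (P j k))^2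
      - 2 * Re ((P i k * cnj (P j k)) * (P j l * cnj (P i l)))" for i j k l
    by (simp add: M_def cmod_diff_square norm_mult power_mult_distrib mult_ac)
  have tot: "(\<Sum>i<a. \<Sum>j<a. \<Sum>k<b. \<Sum>l<b. M i j k l) = 2 * (S^2 - Re (trace (R * R)))"
  proof -
    have "(\<Sum>i<a. \<Sum>j<a. \<Sum>k<b. \<Sum>l<b. (cmod (P i k))^2 * (cmod (P j l))^2) = S^2"
      unfolding S_def power2_eq_square[of "sum _ _"] sum_product
      by (simp add: sum_distrib_left sum_distrib_right sum_product)
    moreover have "(\<Sum>i<a. \<Sum>j<a. \<Sum>k<b. \<Sum>l<b. (cmod (P i l))^2 * (cmod (P j k))^2) = S^2"
    proof -
      have "(\<Sum>i<a. \<Sum>j<a. \<Sum>k<b. \<Sum>l<b. (cmod (P i l))^2 * (cmod (P j k))^2) =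
          (\<Sum>i<a. \<Sum>j<a. \<Sum>l<b. \<Sum>k<b. (cmod (P i l))^2 * (cmod (P j k))^2)"
        by (rule sum.cong[OF refl], rule sum.cong[OF refl], rule sum.swap)
      also have "\<dots> = S^2"
        unfolding S_def power2_eq_square[of "sum _ _"] sum_product
        by (simp add: sum_distrib_left sum_distrib_right sum_product)
      finally show ?thesis .
    qed
    moreover have "(\<Sum>i<a. \<Sum>j<a. \<Sum>k<b. \<Sum>l<b. Re ((P i k * cnj (P j k)) * (P j l * cnj (P i l)))) = Re (trace (R * R))"
    proof -
      have "trace (R * R) = (\<Sum>i<a. \<Sum>j<a. R $$ (i,j) * R $$ (j,i))"
        using Rc by (simp add: trace_def mat_mult_index del: index_mult_mat(1))
      also have "\<dots> = (\<Sum>i<a. \<Sum>j<a. \<Sum>k<b. \<Sum>l<b. (P i k * cnj (P j k)) * (P j l * cnj (P i l)))"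
        by (intro sum.cong refl) (simp add: Rij sum_product)
      finally show ?thesis by simp
    qed
    ultimately show ?thesis
      by (simp add: exp sum.distrib sum_subtractf sum_distrib_left[symmetric])
  qed
  have M0: "0 \<le> M i j k l" for i j k l by (simp add: M_def)
  have "M i j k l \<le> (\<Sum>l<b. M i j k l)"
    using ij M0 by (intro member_le_sum) auto
  also have "\<dots> \<le> (\<Sum>k<b. \<Sum>l<b. M i j k l)"
    using ij M0 by (intro member_le_sum[of k _ "\<lambda>k. \<Sum>l<b. M i j k l"]) (auto intro!: sum_nonneg)
  also have "\<dots> \<le> (\<Sum>j<a. \<Sum>k<b. \<Sum>l<b. M i j k l)"
    using ij M0 by (intro member_le_sum[of j _ "\<lambda>j. \<Sum>k<b. \<Sum>l<b. M i j k l"]) (auto intro!: sum_nonneg)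
  also have "\<dots> \<le> (\<Sum>i<a. \<Sum>j<a. \<Sum>k<b. \<Sum>l<b. M i j k l)"
    using ij M0 by (intro member_le_sum[of i _ "\<lambda>i. \<Sum>j<a. \<Sum>k<b. \<Sum>l<b. M i j k l"]) (auto intro!: sum_nonneg)
  also have "\<dots> \<le> 2 * (S * hent R)"
    unfolding tot using hent_nonneg_lower(2)[OF psd] by (simp add: trS)
  finally show ?thesis
    using trace_gram_coefmat[OF v] trS by (simp add: M_def P_def R_def C_def cost_def)
qed

definition kron_vec :: "nat \<Rightarrow> complex vec \<Rightarrow> complex vec \<Rightarrow> complex vec" where
  "kron_vec b x y = vec (dim_vec x * b) (\<lambda>n. x $ (n div b) * y $ (n mod b))"

lemma kron_vec_carrier: "x \<in> carrier_vec a \<Longrightarrow> kron_vec b x y \<in> carrier_vec (a*b)"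
  by (auto simp: kron_vec_def intro!: carrier_vecI)

lemma kron_vec_index:
  "x \<in> carrier_vec a \<Longrightarrow> i < a \<Longrightarrow> k < b \<Longrightarrow> kron_vec b x y $ (i*b + k) = x $ i * y $ k"
  using product_index_less[of i a k b] by (auto simp: kron_vec_def)

lemma proj_kron_vec:
  assumes "x \<in> carrier_vec a" "y \<in> carrier_vec b"
  shows "proj (kron_vec b x y) = kron (proj x) (proj y)"
  by (rule eq_matI)
     (use assms in \<open>auto simp: proj_def kron_def kron_vec_def product_index_div_mod\<close>)

text \<open>The coefficient matrix is a column times a row; moving the column to the back leaves a
  matrix of size 1, which has entropy 0.\<close>

lemma cost_kron_vec:
  assumes x: "x \<in> carrier_vec a" and y: "y \<in> carrier_vec b"
  shows "cost a b (kron_vec b x y) = 0"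
proof -
  define X where "X = mat a 1 (\<lambda>(i,_). x $ i)"
  define Y where "Y = mat 1 b (\<lambda>(_,k). y $ k)"
  define C where "C = coefmat a b (kron_vec b x y)"
  have c: "X \<in> carrier_mat a 1" "Y \<in> carrier_mat 1 b" "C \<in> carrier_mat a b" by (auto simp: X_def Y_def C_def)
  have "C = X * Y"
    by (rule eq_matI) (use x y in \<open>auto simp: C_def X_def Y_def kron_vec_index mat_mult_index simp del: index_mult_mat(1)\<close>)
  then have "C * mat_adjoint C = X * (Y * mat_adjoint C)"
    using c by (simp add: assoc_mult_mat[of _ a 1 _ b _ a])
  then have "hent (C * mat_adjoint C) = hent ((Y * mat_adjoint C) * X)"
    using c by (simp add: hent_mult_swap[of X a 1])
  also have "\<dots> = 0" using c by (intro hent_dim_1) auto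
  finally show ?thesis by (simp add: cost_def C_def)
qed

text \<open>Choose a nonzero entry (i0,k0) as pivot: \<open>x\<close> is column k0 and
  \<open>y\<close> is row i0 divided by the pivot. The minors through the pivot express every other
  entry as a product.\<close>

lemma product_vec_factor:
  assumes v: "v \<in> carrier_vec (a*b)" and p: "product_vec a b v"
  obtains x y where "x \<in> carrier_vec a" "y \<in> carrier_vec b" "v = kron_vec b x y"
proof (cases "\<exists>n<a*b. v $ n \<noteq> 0")
  case False
  have "v = kron_vec b (0\<^sub>v a) (0\<^sub>v b)"
    by (rule eq_vecI) (use v False in \<open>auto simp: kron_vec_def product_index_div_mod\<close>)
  then show ?thesis using that[of "0\<^sub>v a" "0\<^sub>v b"] by auto
next
  case True
  then obtain n where n: "n < a*b" "v $ n \<noteq> 0" by blast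
  define i0 k0 where "i0 = n div b" and "k0 = n mod b"
  have ik: "i0 < a" "k0 < b" "v $ (i0*b + k0) \<noteq> 0"
    using n product_index_div_mod[OF n(1)] by (auto simp: i0_def k0_def)
  define x where "x = vec a (\<lambda>i. v $ (i*b + k0))"
  define y where "y = vec b (\<lambda>k. v $ (i0*b + k) / v $ (i0*b + k0))"
  have vxy: "v = kron_vec b x y"
  proof (rule eq_vecI)
    fix m assume "m < dim_vec (kron_vec b x y)"
    then have m: "m < a*b" by (simp add: kron_vec_def x_def)
    note dm = product_index_div_mod[OF m]
    have "v $ ((m div b)*b + m mod b) * v $ (i0*b + k0) = v $ ((m div b)*b + k0) * v $ (i0*b + m mod b)"
      using p dm ik unfolding product_vec_def by blast
    then show "v $ m = kron_vec b x y $ m"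
      using m dm(1,2) ik(3) by (simp add: kron_vec_def x_def y_def eq_divide_eq dm(3))
  qed (use v in \<open>auto simp: kron_vec_def x_def\<close>)
  show ?thesis by (rule that[OF _ _ vxy]) (simp_all add: x_def y_def)
qed

lemma density_op_proj_normalised:
  assumes x: "x \<in> carrier_vec n" and s: "s = Re (cinner x x)" "s > 0"
  shows "density_op n (of_real (1 / s) \<cdot>\<^sub>m proj x)"
proof -
  define x' where "x' = of_real (1 / sqrt s) \<cdot>\<^sub>v x"
  have c2: "(cmod (of_real (1 / sqrt s)))^2 = 1 / s" using s by (simp add: norm_divide power_divide)
  have "of_real (1 / s) \<cdot>\<^sub>m proj x = proj x'" unfolding x'_def proj_smult c2 ..
  moreover have "psd n (proj x')"
    unfolding proj_gram using x by (intro psd_gram) (auto simp: x'_def)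
  moreover have "cinner x x = of_real s" using s(1) by (simp add: cinner_self)
  then have "trace (of_real (1 / s) \<cdot>\<^sub>m proj x) = 1"
    using s(2) by (simp add: trace_smult[OF proj_carrier[OF x]] trace_proj)
  ultimately show ?thesis by (simp add: density_op_iff_psd)
qed

lemma kron_smult: "kron (c \<cdot>\<^sub>m A) (d \<cdot>\<^sub>m B) = (c * d) \<cdot>\<^sub>m kron A B"
proof (rule eq_matI)
  fix i j assume "i < dim_row ((c * d) \<cdot>\<^sub>m kron A B)" "j < dim_col ((c * d) \<cdot>\<^sub>m kron A B)"
  then have "i < dim_row A * dim_row B" "j < dim_col A * dim_col B" by auto
  then show "kron (c \<cdot>\<^sub>m A) (d \<cdot>\<^sub>m B) $$ (i,j) = ((c * d) \<cdot>\<^sub>m kron A B) $$ (i,j)"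
    by (simp add: kron_def product_index_div_mod)
qed auto

lemma separable_of_product_ensemble:
  assumes V: "set V \<subseteq> carrier_vec (a*b)" and p: "\<And>v. v \<in> set V \<Longrightarrow> product_vec a b v"
    and tr: "trace (ensemble (a*b) V) = 1"
  shows "separable a b (ensemble (a*b) V)"
proof -
  have "\<forall>v. \<exists>x y. v \<in> set V \<longrightarrow> x \<in> carrier_vec a \<and> y \<in> carrier_vec b \<and> v = kron_vec b x y"
    using product_vec_factor V p by (metis subsetD)
  then obtain x y where "\<forall>v\<in>set V. x v \<in> carrier_vec a \<and> y v \<in> carrier_vec b \<and> v = kron_vec b (x v) (y v)"
    unfolding choice_iff by blast
  then have xy: "x v \<in> carrier_vec a" "y v \<in> carrier_vec b" "kron_vec b (x v) (y v) = v" if "v \<in> set V" for v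
    using that by auto
  define s where "s v = Re (cinner v v)" for v :: "complex vec"
  have s0: "0 \<le> s v" for v by (auto simp: s_def cinner_self intro!: sum_nonneg)
  have cs: "cinner v v = of_real (s v)" for v by (simp add: s_def cinner_self)
  have sk: "s v = s (x v) * s (y v)" if "v \<in> set V" for v
  proof -
    have "dim_vec v = a*b" using V that by auto
    then have "s v = (\<Sum>i<a. \<Sum>k<b. (cmod (v $ (i*b + k)))^2)"
      by (simp add: s_def cinner_self sum_product_index)
    also have "\<dots> = (\<Sum>i<a. \<Sum>k<b. (cmod (kron_vec b (x v) (y v) $ (i*b + k)))^2)"
      by (simp add: xy(3)[OF that])
    also have "\<dots> = (\<Sum>i<a. \<Sum>k<b. (cmod (x v $ i))^2 * (cmod (y v $ k))^2)"
      by (intro sum.cong refl) (simp add: kron_vec_index[OF xy(1)[OF that]] norm_mult power_mult_distrib)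
    also have "\<dots> = s (x v) * s (y v)"
      using xy(1,2)[OF that] by (auto simp: s_def cinner_self sum_product)
    finally show ?thesis .
  qed
  have "\<exists>v0 \<in> set V. s v0 \<noteq> 0"
  proof (rule ccontr)
    assume "\<not> ?thesis"
    then have "(\<Sum>v\<leftarrow>V. cinner v v) = (\<Sum>v\<leftarrow>V. 0)"
      by (intro arg_cong[where f=sum_list] map_cong refl) (auto simp: cs)
    then show False using tr trace_ensemble[OF V] by simp
  qed
  then obtain v0 where v0: "v0 \<in> set V" "s v0 \<noteq> 0" by blast
  \<comment> \<open>\<open>separable\<close> asks for density operators even in terms of weight 0,
    so a zero vector borrows the factors of the nonzero vector \<open>v0\<close>.\<close>
  define z where "z v = (if s v = 0 then v0 else v)" for v
  have z: "z v \<in> set V" "s (z v) > 0" if "v \<in> set V" for v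
    using that v0 s0[of v] s0[of v0] by (auto simp: z_def less_le)
  define \<sigma>A where "\<sigma>A v = of_real (1 / s (x (z v))) \<cdot>\<^sub>m proj (x (z v))" for v
  define \<sigma>B where "\<sigma>B v = of_real (1 / s (y (z v))) \<cdot>\<^sub>m proj (y (z v))" for v
  have pos: "s (x (z v)) > 0" "s (y (z v)) > 0" if "v \<in> set V" for v
    using z[OF that] sk[of "z v"] s0[of "x (z v)"] s0[of "y (z v)"] by (auto simp: less_le)
  have dens: "density_op a (\<sigma>A v)" "density_op b (\<sigma>B v)" if "v \<in> set V" for v
    unfolding \<sigma>A_def \<sigma>B_def
    by (intro density_op_proj_normalised xy z(1) pos s_def that)+
  have kr: "of_real (s v) \<cdot>\<^sub>m kron (\<sigma>A v) (\<sigma>B v) = proj v" if v: "v \<in> set V" for v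
  proof (cases "s v = 0")
    case True
    then have "v $ i = 0" if "i < dim_vec v" for i
      using that by (simp add: s_def cinner_self sum_nonneg_eq_0_iff)
    then have "proj v = 0\<^sub>m (a*b) (a*b)" using V v by (intro eq_matI) (auto simp: proj_def)
    moreover have "kron (\<sigma>A v) (\<sigma>B v) \<in> carrier_mat (a*b) (a*b)"
      using dens[OF v] by (intro kron_carrier) (auto simp: density_op_def)
    moreover have "(0::complex) \<cdot>\<^sub>m G = 0\<^sub>m n n" if "G \<in> carrier_mat n n" for G n
      using that by (intro eq_matI) auto
    ultimately show ?thesis using True by simp
  next
    case False
    then have zv: "z v = v" by (simp add: z_def)
    have "kron (\<sigma>A v) (\<sigma>B v) = (of_real (1 / s (x v)) * of_real (1 / s (y v))) \<cdot>\<^sub>m kron (proj (x v)) (proj (y v))"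
      unfolding \<sigma>A_def \<sigma>B_def zv kron_smult ..
    also have "of_real (1 / s (x v)) * of_real (1 / s (y v)) = (of_real (1 / s v) :: complex)"
      using sk[OF v] by simp
    also have "kron (proj (x v)) (proj (y v)) = proj v"
      using proj_kron_vec[OF xy(1,2)[OF v]] xy(3)[OF v] by simp
    finally show ?thesis using False by (auto intro!: eq_matI)
  qed
  show ?thesis unfolding separable_def
  proof (intro exI conjI)
    show "\<forall>i<length V. 0 \<le> s (V ! i) \<and> density_op a (\<sigma>A (V ! i)) \<and> density_op b (\<sigma>B (V ! i))"
      using s0 dens by auto
    have "of_real (\<Sum>i<length V. s (V ! i)) = (\<Sum>v\<leftarrow>V. cinner v v)"
      by (simp add: cs sum_list_sum_nth lessThan_atLeast0)
    also have "\<dots> = 1" using tr trace_ensemble[OF V] by simp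
    finally show "(\<Sum>i<length V. s (V ! i)) = 1" by (metis of_real_eq_1_iff)
    have "map (\<lambda>i. of_real (s (V ! i)) \<cdot>\<^sub>m kron (\<sigma>A (V ! i)) (\<sigma>B (V ! i))) [0..<length V] = map proj V"
      using kr by (intro nth_equalityI) auto
    then show "ensemble (a*b) V = msum (a*b) (a*b)
        (map (\<lambda>i. of_real (s (V ! i)) \<cdot>\<^sub>m kron (\<sigma>A (V ! i)) (\<sigma>B (V ! i))) [0..<length V])"
      by (simp add: ensemble_def)
  qed
qed

lemma kron_ensemble:
  assumes X: "set X \<subseteq> carrier_vec a" and Y: "set Y \<subseteq> carrier_vec b"
  shows "kron (ensemble a X) (ensemble b Y) =
    ensemble (a*b) (concat (map (\<lambda>x. map (\<lambda>y. kron_vec b x y) Y) X))"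
proof (rule eq_matI)
  fix i j assume "i < dim_row (ensemble (a*b) (concat (map (\<lambda>x. map (\<lambda>y. kron_vec b x y) Y) X)))"
    "j < dim_col (ensemble (a*b) (concat (map (\<lambda>x. map (\<lambda>y. kron_vec b x y) Y) X)))"
  then have ij: "i < a*b" "j < a*b" by auto
  have e: "ensemble n V $$ (i,j) = (\<Sum>v\<leftarrow>V. proj v $$ (i,j))" if "i < n" "j < n" for n V i j
    using that by (simp add: ensemble_def msum_def o_def)
  have "kron (ensemble a X) (ensemble b Y) $$ (i,j) =
      (\<Sum>x\<leftarrow>X. proj x $$ (i div b, j div b)) * (\<Sum>y\<leftarrow>Y. proj y $$ (i mod b, j mod b))"
    using ij by (simp add: kron_def e product_index_div_mod)
  also have "\<dots> = (\<Sum>x\<leftarrow>X. \<Sum>y\<leftarrow>Y. proj x $$ (i div b, j div b) * proj y $$ (i mod b, j mod b))"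
    by (simp add: sum_list_const_mult sum_list_mult_const)
  also have "\<dots> = (\<Sum>x\<leftarrow>X. \<Sum>y\<leftarrow>Y. proj (kron_vec b x y) $$ (i,j))"
    using X Y ij
    by (intro arg_cong[where f=sum_list] map_cong refl)
       (auto simp: proj_def kron_vec_def product_index_div_mod dest!: subsetD)
  also have "\<dots> = ensemble (a*b) (concat (map (\<lambda>x. map (\<lambda>y. kron_vec b x y) Y) X)) $$ (i,j)"
    using ij by (simp add: e sum_list_concat_map o_def)
  finally show "kron (ensemble a X) (ensemble b Y) $$ (i,j) =
    ensemble (a*b) (concat (map (\<lambda>x. map (\<lambda>y. kron_vec b x y) Y) X)) $$ (i,j)" .
qed auto

text \<open>Spectral ensembles of the two local states combine into an ensemble of product vectors,
  each of cost 0.\<close>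

lemma separable_imp_product_ensemble:
  assumes "separable a b \<rho>"
  obtains V where "set V \<subseteq> carrier_vec (a*b)" "\<rho> = ensemble (a*b) V" "costs a b V = 0"
proof -
  from assms obtain n p \<sigma>A \<sigma>B where p: "\<And>i. i < n \<Longrightarrow> 0 \<le> p i"
    and \<sigma>: "\<And>i. i < n \<Longrightarrow> density_op a (\<sigma>A i)" "\<And>i. i < n \<Longrightarrow> density_op b (\<sigma>B i)"
    and \<rho>: "\<rho> = msum (a*b) (a*b) (map (\<lambda>i. of_real (p i) \<cdot>\<^sub>m kron (\<sigma>A i) (\<sigma>B i)) [0..<n])"
    unfolding separable_def by blast
  have "\<exists>V. set V \<subseteq> carrier_vec (a*b) \<and> of_real (p i) \<cdot>\<^sub>m kron (\<sigma>A i) (\<sigma>B i) = ensemble (a*b) V \<and> costs a b V = 0"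
    if i: "i < n" for i
  proof -
    obtain X where X: "set X \<subseteq> carrier_vec a" "\<sigma>A i = ensemble a X"
      using psd_ensemble \<sigma>(1)[OF i] by (metis density_op_iff_psd)
    obtain Y where Y: "set Y \<subseteq> carrier_vec b" "\<sigma>B i = ensemble b Y"
      using psd_ensemble \<sigma>(2)[OF i] by (metis density_op_iff_psd)
    define W where "W = concat (map (\<lambda>x. map (\<lambda>y. kron_vec b x y) Y) X)"
    have W: "set W \<subseteq> carrier_vec (a*b)" using X(1) by (auto simp: W_def intro!: kron_vec_carrier)
    have cW: "cost a b w = 0" if "w \<in> set W" for w
      using that X(1) Y(1) by (auto simp: W_def intro!: cost_kron_vec)
    define V where "V = map (\<lambda>w. of_real (sqrt (p i)) \<cdot>\<^sub>v w) W"
    have "of_real (p i) \<cdot>\<^sub>m kron (\<sigma>A i) (\<sigma>B i) = ensemble (a*b) V"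
      unfolding V_def ensemble_smult[OF W] X(2) Y(2) kron_ensemble[OF X(1) Y(1)] W_def[symmetric]
      using p[OF i] by simp
    moreover have "costs a b V = (\<Sum>w\<leftarrow>W. 0)"
      unfolding costs_def V_def map_map using cW W
      by (intro arg_cong[where f=sum_list] map_cong refl) (auto simp: cost_smult)
    moreover have "set V \<subseteq> carrier_vec (a*b)" using W by (auto simp: V_def)
    ultimately show ?thesis by auto
  qed
  then have "\<forall>i. \<exists>V. i < n \<longrightarrow> set V \<subseteq> carrier_vec (a*b) \<and>
      of_real (p i) \<cdot>\<^sub>m kron (\<sigma>A i) (\<sigma>B i) = ensemble (a*b) V \<and> costs a b V = 0" by blast
  from choice[OF this] obtain V where V: "\<forall>i. i < n \<longrightarrow> set (V i) \<subseteq> carrier_vec (a*b) \<and>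
      of_real (p i) \<cdot>\<^sub>m kron (\<sigma>A i) (\<sigma>B i) = ensemble (a*b) (V i) \<and> costs a b (V i) = 0" ..
  show ?thesis
  proof
    show "set (concat (map V [0..<n])) \<subseteq> carrier_vec (a*b)" using V by fastforce
    show "\<rho> = ensemble (a*b) (concat (map V [0..<n]))"
      unfolding \<rho> ensemble_concat map_map
      using V by (intro arg_cong[where f="msum (a*b) (a*b)"] map_cong refl) auto
    show "costs a b (concat (map V [0..<n])) = 0"
      using V by (simp add: costs_concat o_def interv_sum_list_conv_sum_set_nat)
  qed
qed

section \<open>Attainment of the infimum and faithfulness\<close>

text \<open>The \<open>N\<close> equations are padded with zero rows to a square matrix; row
  \<open>N\<close> is zero, so the determinant vanishes and the kernel is nontrivial.\<close>

lemma homogeneous_system_nontrivial: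
  fixes f :: "nat \<Rightarrow> nat \<Rightarrow> real"
  assumes "N < n"
  obtains c where "\<exists>i<n. c i \<noteq> 0" "\<And>r. r < N \<Longrightarrow> (\<Sum>i<n. c i * f r i) = 0"
proof -
  define A where "A = mat n n (\<lambda>(r,i). if r < N then f r i else 0)"
  have A: "A \<in> carrier_mat n n" by (simp add: A_def)
  have "A = mat\<^sub>r n n (\<lambda>r. if r = N then 0\<^sub>v n else row A r)"
    by (rule eq_matI) (auto simp: A_def)
  then have "det A = 0" using det_row_0[OF assms, of "row A"] A by auto
  then obtain v where v: "v \<in> carrier_vec n" "v \<noteq> 0\<^sub>v n" "A *\<^sub>v v = 0\<^sub>v n"
    using det_0_iff_vec_prod_zero_field[OF A] by blast
  show ?thesis
  proof
    show "\<exists>i<n. v $ i \<noteq> 0"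
    proof (rule ccontr)
      assume "\<not> ?thesis"
      then have "v = 0\<^sub>v n" using v(1) by (intro eq_vecI) auto
      with v(2) show False ..
    qed
    fix r assume r: "r < N"
    have "(\<Sum>i<n. v $ i * f r i) = (A *\<^sub>v v) $ r"
      using r assms v(1)
      by (auto simp: A_def scalar_prod_def lessThan_atLeast0 mult.commute intro!: sum.cong)
    then show "(\<Sum>i<n. v $ i * f r i) = 0" using v(3) r assms by simp
  qed
qed

lemma ensemble_index:
  "p < n \<Longrightarrow> q < n \<Longrightarrow> ensemble n V $$ (p,q) = (\<Sum>v\<leftarrow>V. proj v $$ (p,q))"
  by (simp add: ensemble_def msum_def o_def)

lemma sum_list_filter_neq:
  fixes g :: "nat \<Rightarrow> 'a::comm_monoid_add"
  assumes "m < n" "g m = 0"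
  shows "(\<Sum>i\<leftarrow>filter (\<lambda>i. i \<noteq> m) [0..<n]. g i) = (\<Sum>i<n. g i)"
proof -
  have "(\<Sum>i\<leftarrow>filter (\<lambda>i. i \<noteq> m) [0..<n]. g i) = (\<Sum>i\<in>set (filter (\<lambda>i. i \<noteq> m) [0..<n]). g i)"
    by (rule sum_list_distinct_conv_sum_set) simp
  also have "\<dots> = (\<Sum>i<n. g i)"
    using assms by (intro sum.mono_neutral_left) auto
  finally show ?thesis .
qed

text \<open>One step of Caratheodory's theorem for the vectors \<open>(proj v, cost v)\<close> in a real space of
  dimension \<open>2 D^2 + 1\<close>.\<close>

lemma ensemble_shorten:
  assumes V: "set V \<subseteq> carrier_vec (a*b)" and len: "2 * ((a*b) * (a*b)) + 1 < length V"
  obtains V' where "length V' < length V" "set V' \<subseteq> carrier_vec (a*b)"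
    "ensemble (a*b) V' = ensemble (a*b) V" "costs a b V' = costs a b V"
proof -
  define D L where "D = a*b" and "L = length V"
  have Vi: "V ! i \<in> carrier_vec D" if "i < L" for i using V that by (auto simp: L_def D_def)
  \<comment> \<open>Row 2x holds the real part and row 2x+1 the imaginary part of the entry of
    \<open>proj (V ! i)\<close> with flattened index x; the last row, 2 D^2, holds the cost.\<close>
  define f where "f r i = (if r = 2 * (D*D) then cost a b (V ! i)
      else (if even r then Re else Im) (proj (V ! i) $$ ((r div 2) div D, (r div 2) mod D)))" for r i
  obtain c0 where c0: "\<exists>i<L. c0 i \<noteq> 0" "\<And>r. r < 2 * (D*D) + 1 \<Longrightarrow> (\<Sum>i<L. c0 i * f r i) = 0"
    using homogeneous_system_nontrivial[of "2 * (D*D) + 1" L f] len by (auto simp: L_def D_def)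
  \<comment> \<open>The choice of weights below needs a negative coefficient; if \<open>c0\<close>
    has none, its negative has one.\<close>
  obtain c where c: "\<exists>i<L. c i < 0" "\<And>r. r < 2 * (D*D) + 1 \<Longrightarrow> (\<Sum>i<L. c i * f r i) = 0"
  proof (cases "\<exists>i<L. c0 i < 0")
    case True
    then show ?thesis using that c0 by blast
  next
    case False
    then have "\<exists>i<L. - c0 i < 0" using c0(1) by force
    then show ?thesis using that[of "\<lambda>i. - c0 i"] c0(2) by (simp add: sum_negf)
  qed
  have ccost: "(\<Sum>i<L. c i * cost a b (V ! i)) = 0"
    using c(2)[of "2 * (D*D)"] by (simp add: f_def)
  have cproj: "(\<Sum>i<L. of_real (c i) * proj (V ! i) $$ (p,q)) = 0" if pq: "p < D" "q < D" for p q
  proof -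
    define x where "x = p * D + q"
    have x: "x < D*D" "x div D = p" "x mod D = q" using pq product_index_less[of p D q D] by (auto simp: x_def)
    have "(\<Sum>i<L. c i * f (2 * x) i) = 0" "(\<Sum>i<L. c i * f (2 * x + 1) i) = 0"
      using x(1) by (auto intro!: c(2))
    moreover have "2 * x \<noteq> 2 * (D*D)" "2 * x + 1 \<noteq> 2 * (D*D)" using x(1) by presburger+
    ultimately show ?thesis using x by (simp add: f_def complex_eq_iff)
  qed
  have "finite (c ` {..<L})" "c ` {..<L} \<noteq> {}" using c(1) by auto
  then have "Min (c ` {..<L}) \<in> c ` {..<L}" by (rule Min_in)
  then obtain m where m: "m < L" "c m = Min (c ` {..<L})" by auto
  have cm: "c m \<le> c i" if "i < L" for i using that m(2) by simp
  have neg: "c m < 0" using c(1) cm by (meson less_le_trans not_le)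
  \<comment> \<open>The weights start at 1 and move along the dependency until the first of them
    reaches 0. Since \<open>c m\<close> is the least coefficient and negative, this happens at
    \<open>m\<close> while the others stay nonnegative.\<close>
  define w where "w i = 1 - c i / c m" for i
  have w0: "0 \<le> w i" if "i < L" for i
    using cm[OF that] neg by (simp add: w_def divide_le_eq_1)
  have wm: "w m = 0" using neg by (simp add: w_def)
  define V' where "V' = map (\<lambda>i. of_real (sqrt (w i)) \<cdot>\<^sub>v V ! i) (filter (\<lambda>i. i \<noteq> m) [0..<L])"
  show ?thesis
  proof
    have "length (filter (\<lambda>i. i \<noteq> m) [0..<L]) < length [0..<L]"
      using m(1) by (intro length_filter_less[of m]) auto
    then show "length V' < length V" by (simp add: V'_def L_def)
    show "set V' \<subseteq> carrier_vec (a*b)" using Vi by (auto simp: V'_def D_def)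
    show "ensemble (a*b) V' = ensemble (a*b) V"
    proof (rule eq_matI)
      fix p q assume "p < dim_row (ensemble (a*b) V)" "q < dim_col (ensemble (a*b) V)"
      then have pq: "p < D" "q < D" by (auto simp: D_def)
      have pr: "proj (of_real (sqrt (w i)) \<cdot>\<^sub>v V ! i) $$ (p,q) = of_real (w i) * proj (V ! i) $$ (p,q)" if "i < L" for i
        using pq w0[OF that] proj_carrier[OF Vi[OF that]] unfolding proj_smult by simp
      have "ensemble (a*b) V' $$ (p,q) =
          (\<Sum>i\<leftarrow>filter (\<lambda>i. i \<noteq> m) [0..<L]. of_real (w i) * proj (V ! i) $$ (p,q))"
        using pq unfolding D_def
        by (subst ensemble_index) (auto simp: V'_def o_def pr[unfolded D_def] intro!: arg_cong[where f=sum_list] map_cong)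
      also have "\<dots> = (\<Sum>i<L. of_real (w i) * proj (V ! i) $$ (p,q))"
        by (rule sum_list_filter_neq) (use m wm in auto)
      also have "\<dots> = (\<Sum>i<L. proj (V ! i) $$ (p,q)) - (\<Sum>i<L. of_real (c i) * proj (V ! i) $$ (p,q)) / of_real (c m)"
        by (simp add: w_def left_diff_distrib sum_subtractf sum_divide_distrib)
      also have "\<dots> = ensemble (a*b) V $$ (p,q)"
        using pq cproj[OF pq] by (simp add: ensemble_index D_def sum_list_sum_nth L_def lessThan_atLeast0)
      finally show "ensemble (a*b) V' $$ (p,q) = ensemble (a*b) V $$ (p,q)" .
    qed auto
    have "costs a b V' = (\<Sum>i\<leftarrow>filter (\<lambda>i. i \<noteq> m) [0..<L]. w i * cost a b (V ! i))"
      unfolding costs_def V'_def map_map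
      by (intro arg_cong[where f=sum_list] map_cong refl) (use Vi w0 in \<open>auto simp: cost_smult D_def\<close>)
    also have "\<dots> = (\<Sum>i<L. w i * cost a b (V ! i))"
      by (rule sum_list_filter_neq) (use m wm in auto)
    also have "\<dots> = (\<Sum>i<L. cost a b (V ! i)) - (\<Sum>i<L. c i * cost a b (V ! i)) / c m"
      by (simp add: w_def left_diff_distrib sum_subtractf sum_divide_distrib)
    also have "\<dots> = costs a b V"
      unfolding ccost by (simp add: costs_def sum_list_sum_nth L_def lessThan_atLeast0)
    finally show "costs a b V' = costs a b V" .
  qed
qed

text \<open>Shortening is followed by padding with zero vectors: with a length common to all
  ensembles, a sequence of them lives in one space of finite dimension.\<close>

lemma ensemble_bounded_length:
  assumes "set V \<subseteq> carrier_vec (a*b)"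
  shows "\<exists>V'. length V' = 2 * ((a*b) * (a*b)) + 1 \<and> set V' \<subseteq> carrier_vec (a*b) \<and>
    ensemble (a*b) V' = ensemble (a*b) V \<and> costs a b V' = costs a b V"
  using assms
proof (induction "length V" arbitrary: V rule: less_induct)
  case (less V)
  show ?case
  proof (cases "2 * ((a*b) * (a*b)) + 1 < length V")
    case True
    then show ?thesis using ensemble_shorten[OF less.prems True] less.hyps by metis
  next
    case False
    define k where "k = 2 * ((a*b) * (a*b)) + 1 - length V"
    define Z where "Z = replicate k (0\<^sub>v (a*b) :: complex vec)"
    have z: "0\<^sub>v (a*b) = (0::complex) \<cdot>\<^sub>v 0\<^sub>v (a*b)" by auto
    have "cost a b (0\<^sub>v (a*b)) = 0" by (subst z, subst cost_smult) auto
    then have "costs a b Z = 0" by (simp add: Z_def costs_def sum_list_replicate)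
    moreover have "ensemble (a*b) Z = 0\<^sub>m (a*b) (a*b)"
      by (rule eq_matI) (auto simp: ensemble_index Z_def sum_list_replicate proj_def)
    ultimately show ?thesis using less.prems False
      by (intro exI[of _ "V @ Z"]) (auto simp: ensemble_append costs_append Z_def k_def)
  qed
qed

text \<open>Bolzano-Weierstrass one coordinate at a time: a bounded monotone subsequence settles the
  new coordinate, and the earlier ones still converge along it.\<close>

lemma convergent_subsequence_finite:
  fixes f :: "nat \<Rightarrow> 'i \<Rightarrow> real"
  assumes "finite I" "\<And>n i. i \<in> I \<Longrightarrow> \<bar>f n i\<bar> \<le> B"
  shows "\<exists>r. strict_mono r \<and> (\<forall>i\<in>I. convergent (\<lambda>n. f (r n) i))"
  using assms
proof (induction I rule: finite_induct)
  case empty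
  show ?case by (intro exI[of _ id]) (auto simp: strict_mono_def)
next
  case (insert i I)
  then obtain r where r: "strict_mono r" "\<And>j. j \<in> I \<Longrightarrow> convergent (\<lambda>n. f (r n) j)" by auto
  obtain g where g: "strict_mono g" "monoseq (\<lambda>n. f (r (g n)) i)"
    using seq_monosub[of "\<lambda>n. f (r n) i"] by auto
  have "Bseq (\<lambda>n. f (r (g n)) i)" using insert.prems by (intro BseqI'[of _ B]) auto
  then have "convergent (\<lambda>n. f (r (g n)) i)" using g(2) by (rule Bseq_monoseq_convergent)
  moreover have "convergent (\<lambda>n. f (r (g n)) j)" if "j \<in> I" for j
    using convergent_subseq_convergent[OF r(2)[OF that] g(1)] by (simp add: o_def)
  moreover have "strict_mono (\<lambda>n. r (g n))" using strict_mono_o[OF r(1) g(1)] by (simp add: o_def)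
  ultimately show ?case by (intro exI[of _ "\<lambda>n. r (g n)"]) auto
qed

lemma convergent_subsequence_complex:
  fixes f :: "nat \<Rightarrow> 'i \<Rightarrow> complex"
  assumes "finite I" "\<And>n i. i \<in> I \<Longrightarrow> cmod (f n i) \<le> B"
  obtains r l where "strict_mono (r :: nat \<Rightarrow> nat)" "\<And>i. i \<in> I \<Longrightarrow> (\<lambda>n. f (r n) i) \<longlonglongrightarrow> l i"
proof -
  define g where "g n = (\<lambda>(i,s). if s then Re (f n i) else Im (f n i))" for n
  have "\<bar>g n x\<bar> \<le> B" if "x \<in> I \<times> UNIV" for n x
    using that order_trans[OF abs_Re_le_cmod assms(2)] order_trans[OF abs_Im_le_cmod assms(2)]
    by (auto simp: g_def)
  then obtain r where r: "strict_mono r" "\<forall>x\<in>I \<times> UNIV. convergent (\<lambda>n. g (r n) x)"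
    using convergent_subsequence_finite[of "I \<times> UNIV" g B] assms(1) by auto
  define l where "l i = Complex (lim (\<lambda>n. Re (f (r n) i))) (lim (\<lambda>n. Im (f (r n) i)))" for i
  show ?thesis
  proof (rule that[OF r(1)])
    fix i assume i: "i \<in> I"
    have "convergent (\<lambda>n. Re (f (r n) i))" "convergent (\<lambda>n. Im (f (r n) i))"
      using r(2)[rule_format, of "(i,True)"] r(2)[rule_format, of "(i,False)"] i by (auto simp: g_def)
    then show "(\<lambda>n. f (r n) i) \<longlonglongrightarrow> l i"
      by (simp add: tendsto_complex_iff l_def convergent_LIMSEQ_iff)
  qed
qed

lemma separable_of_vanishing_costs:
  assumes \<rho>: "density_op (a*b) \<rho>"
    and V: "\<And>m::nat. \<exists>V. set V \<subseteq> carrier_vec (a*b) \<and> \<rho> = ensemble (a*b) V \<and> costs a b V < 1 / (real m + 1)"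
  shows "separable a b \<rho>"
proof -
  define D N where "D = a*b" and "N = 2 * ((a*b) * (a*b)) + 1"
  have "\<forall>m::nat. \<exists>V. length V = N \<and> set V \<subseteq> carrier_vec D \<and> \<rho> = ensemble D V \<and> costs a b V < 1 / (real m + 1)"
    using V ensemble_bounded_length unfolding D_def N_def by metis
  from choice[OF this] obtain V where V0: "\<forall>m::nat. length (V m) = N \<and> set (V m) \<subseteq> carrier_vec D \<and>
     \<rho> = ensemble D (V m) \<and> costs a b (V m) < 1 / (real m + 1)" ..
  then have len: "length (V m) = N" and Vc: "set (V m) \<subseteq> carrier_vec D" and \<rho>V: "\<rho> = ensemble D (V m)"
    and small: "costs a b (V m) < 1 / (real m + 1)" for m by blast+
  have Vi: "V m ! i \<in> carrier_vec D" if "i < N" for i m using Vc[of m] len[of m] that by auto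
  have tr: "trace \<rho> = 1" using \<rho> by (simp add: density_op_def)
  \<comment> \<open>The squared norms are nonnegative and add up to the trace of
    \<open>\<rho>\<close>. This bounds all coordinates by 1, as the extraction of a limit
    requires.\<close>
  have norm1: "Re (cinner (V m ! i) (V m ! i)) \<le> 1" if "i < N" for m i
  proof -
    have "1 = Re (\<Sum>v\<leftarrow>V m. cinner v v)" using tr trace_ensemble[OF Vc, of m] \<rho>V[of m] by simp
    also have "\<dots> = (\<Sum>j<N. Re (cinner (V m ! j) (V m ! j)))"
      by (simp add: sum_list_sum_nth len lessThan_atLeast0)
    finally have "1 = (\<Sum>j<N. Re (cinner (V m ! j) (V m ! j)))" .
    then show ?thesis using that
      member_le_sum[of i "{..<N}" "\<lambda>j. Re (cinner (V m ! j) (V m ! j))"]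
      by (simp add: cinner_self sum_nonneg)
  qed
  have cost1: "cost a b (V m ! i) \<le> 1 / (real m + 1)" if "i < N" for m i
  proof -
    have "cost a b (V m ! i) \<le> (\<Sum>j<N. cost a b (V m ! j))"
      using that by (intro member_le_sum) (auto simp: cost_nonneg)
    also have "\<dots> = costs a b (V m)" by (simp add: costs_def sum_list_sum_nth len lessThan_atLeast0)
    finally show ?thesis using small[of m] by simp
  qed
  have bound: "cmod (V m ! i $ k) \<le> 1" if "i < N" "k < D" for m i k
  proof -
    have "dim_vec (V m ! i) = D" using Vi[OF that(1), of m] by simp
    then have "(cmod (V m ! i $ k))^2 \<le> Re (cinner (V m ! i) (V m ! i))"
      using that(2)
        member_le_sum[of k "{..<D}" "\<lambda>k. (cmod (V m ! i $ k))^2"]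
      by (simp add: cinner_self)
    then have "(cmod (V m ! i $ k))^2 \<le> 1" using norm1[OF that(1), of m] by linarith
    then show ?thesis by (simp add: power_le_one_iff abs_square_le_1)
  qed
  define f where "f m = (\<lambda>(i,k). V m ! i $ k)" for m
  have f: "cmod (f m x) \<le> 1" if "x \<in> {..<N} \<times> {..<D}" for m x
    using bound that by (auto simp: f_def)
  have fin: "finite ({..<N} \<times> {..<D})" by simp
  obtain r w where r: "strict_mono (r :: nat \<Rightarrow> nat)"
    and lim0: "\<And>x. x \<in> {..<N} \<times> {..<D} \<Longrightarrow> (\<lambda>m. f (r m) x) \<longlonglongrightarrow> w x"
    by (rule convergent_subsequence_complex[OF fin, of f 1]) (use f in blast)+
  have lim: "(\<lambda>m. V (r m) ! i $ k) \<longlonglongrightarrow> w (i,k)" if "i < N" "k < D" for i k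
    using lim0[of "(i,k)"] that by (simp add: f_def)
  define W where "W = map (\<lambda>i. vec D (\<lambda>k. w (i,k))) [0..<N]"
  have W: "set W \<subseteq> carrier_vec D" by (auto simp: W_def)
  \<comment> \<open>The entries are polynomials in the coordinates and their conjugates, so the
    constant value \<open>\<rho>\<close> survives in the limit.\<close>
  have "\<rho> = ensemble D W"
  proof (rule eq_matI)
    fix p q assume "p < dim_row (ensemble D W)" "q < dim_col (ensemble D W)"
    then have pq: "p < D" "q < D" by auto
    have "\<rho> $$ (p,q) = (\<Sum>i<N. V m ! i $ p * cnj (V m ! i $ q))" for m
    proof -
      have "\<rho> $$ (p,q) = (\<Sum>v\<leftarrow>V m. proj v $$ (p,q))"
        using \<rho>V[of m] ensemble_index[OF pq] by simp
      also have "\<dots> = (\<Sum>i<N. proj (V m ! i) $$ (p,q))"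
        by (simp add: sum_list_sum_nth len lessThan_atLeast0)
      also have "\<dots> = (\<Sum>i<N. V m ! i $ p * cnj (V m ! i $ q))"
      proof (intro sum.cong refl)
        fix i assume "i \<in> {..<N}"
        then have "dim_vec (V m ! i) = D" using Vi[of i m] by simp
        then show "proj (V m ! i) $$ (p,q) = V m ! i $ p * cnj (V m ! i $ q)"
          using pq by (simp add: proj_def)
      qed
      finally show ?thesis .
    qed
    then have "(\<lambda>m. \<rho> $$ (p,q)) = (\<lambda>m. \<Sum>i<N. V (r m) ! i $ p * cnj (V (r m) ! i $ q))" by blast
    moreover have "(\<lambda>m. \<Sum>i<N. V (r m) ! i $ p * cnj (V (r m) ! i $ q)) \<longlonglongrightarrow> (\<Sum>i<N. w (i,p) * cnj (w (i,q)))"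
      using pq by (intro tendsto_intros lim) auto
    ultimately have "(\<lambda>m. \<rho> $$ (p,q)) \<longlonglongrightarrow> (\<Sum>i<N. w (i,p) * cnj (w (i,q)))" by simp
    then have "\<rho> $$ (p,q) = (\<Sum>i<N. w (i,p) * cnj (w (i,q)))"
      by (rule LIMSEQ_unique[OF tendsto_const])
    also have "\<dots> = ensemble D W $$ (p,q)"
      using pq by (simp add: ensemble_index W_def o_def proj_def interv_sum_list_conv_sum_set_nat lessThan_atLeast0)
    finally show "\<rho> $$ (p,q) = ensemble D W $$ (p,q)" .
  qed (use \<rho> in \<open>auto simp: density_op_def D_def\<close>)
  moreover have "product_vec a b v" if "v \<in> set W" for v
  proof -
    from that obtain n where n: "n < N" and v: "v = vec D (\<lambda>k. w (n,k))" by (auto simp: W_def)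
    show ?thesis unfolding product_vec_def
    proof (intro allI impI)
      fix i j k l assume ijkl: "i < a" "j < a" "k < b" "l < b"
      have x: "i*b+k < D" "j*b+l < D" "i*b+l < D" "j*b+k < D"
        using ijkl by (auto simp: D_def intro: product_index_less)
      define F where "F m = V (r m) ! n $ (i*b+k) * V (r m) ! n $ (j*b+l)
          - V (r m) ! n $ (i*b+l) * V (r m) ! n $ (j*b+k)" for m
      have F: "F \<longlonglongrightarrow> w (n,i*b+k) * w (n,j*b+l) - w (n,i*b+l) * w (n,j*b+k)"
        unfolding F_def by (intro tendsto_intros lim n x)
      have le: "(cmod (F m))^2 \<le> 2 * (1 / (real m + 1))" for m
      proof -
        have "(cmod (F m))^2 \<le> 2 * (Re (cinner (V (r m) ! n) (V (r m) ! n)) * cost a b (V (r m) ! n))"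
          unfolding F_def using Vi[OF n] ijkl by (intro minor_le_cost) (auto simp: D_def)
        also have "\<dots> \<le> 2 * (1 * (1 / (real (r m) + 1)))"
          using norm1[OF n] cost1[OF n] by (intro mult_left_mono mult_mono) (auto simp: cost_nonneg)
        \<comment> \<open>A strictly increasing index sequence satisfies
          \<open>m \<le> r m\<close>.\<close>
        also have "\<dots> \<le> 2 * (1 / (real m + 1))"
          using seq_suble[OF r, of m] by (simp add: frac_le)
        finally show ?thesis .
      qed
      have "(\<lambda>m. 2 * inverse (real (Suc m))) \<longlonglongrightarrow> 2 * 0"
        by (intro tendsto_mult tendsto_const LIMSEQ_inverse_real_of_nat)
      then have lim2: "(\<lambda>m. 2 * (1 / (real m + 1))) \<longlonglongrightarrow> 0"
        by (simp add: inverse_eq_divide add.commute)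
      have "(\<lambda>m. (cmod (F m))^2) \<longlonglongrightarrow> 0"
        by (rule tendsto_sandwich[OF _ _ tendsto_const lim2]) (use le in \<open>intro always_eventually allI, simp\<close>)+
      moreover have "(\<lambda>m. (cmod (F m))^2) \<longlonglongrightarrow>
          (cmod (w (n,i*b+k) * w (n,j*b+l) - w (n,i*b+l) * w (n,j*b+k)))^2"
        by (intro tendsto_intros F)
      ultimately have "(cmod (w (n,i*b+k) * w (n,j*b+l) - w (n,i*b+l) * w (n,j*b+k)))^2 = 0"
        by (rule LIMSEQ_unique[symmetric])
      then show "v $ (i*b + k) * v $ (j*b + l) = v $ (i*b + l) * v $ (j*b + k)"
        using x by (simp add: v)
    qed
  qed
  ultimately show ?thesis
    using separable_of_product_ensemble[of W a b] W tr by (simp add: D_def)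
qed

lemma Et_eq_0_iff_separable:
  assumes \<rho>: "density_op (a*b) \<rho>"
  shows "Et a b \<rho> = 0 \<longleftrightarrow> separable a b \<rho>"
proof
  have a: "0 < a" using density_op_dim_pos[OF \<rho>] by simp
  assume E: "Et a b \<rho> = 0"
  show "separable a b \<rho>"
  \<comment> \<open>Here \<open>rnorm a\<close> is 0 and the hypothesis \<open>E\<close> carries no
    information; but with a one-dimensional A every vector is a product vector.\<close>
  proof (cases "a = 1")
    case True
    obtain V where V: "set V \<subseteq> carrier_vec (a*b)" "\<rho> = ensemble (a*b) V"
      using psd_ensemble \<rho> by (metis density_op_iff_psd)
    have "product_vec a b v" for v using True by (simp add: product_vec_def mult.commute)
    then show ?thesis
      using V \<rho> separable_of_product_ensemble[OF V(1)] by (simp add: density_op_def)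
  next
    case False
    with a have r: "0 < rnorm a" by (intro rnorm_pos) simp
    show ?thesis
    proof (rule separable_of_vanishing_costs[OF \<rho>])
      fix m :: nat
      \<comment> \<open>The slack is chosen to become 1/(m+1) after multiplication by
        \<open>rnorm a\<close>.\<close>
      obtain V where V: "set V \<subseteq> carrier_vec (a*b)" "\<rho> = ensemble (a*b) V"
        "costs a b V / rnorm a < Et a b \<rho> + 1 / ((real m + 1) * rnorm a)"
        using Et_approx[OF \<rho>, of "1 / ((real m + 1) * rnorm a)"] r by (auto simp: add_nonneg_pos)
      have "1 / ((real m + 1) * rnorm a) = (1 / (real m + 1)) / rnorm a" by simp
      then have "costs a b V / rnorm a < (1 / (real m + 1)) / rnorm a" using V(3) E by simp
      then have "costs a b V < 1 / (real m + 1)" using r by (simp only: divide_less_cancel)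
      then show "\<exists>V. set V \<subseteq> carrier_vec (a*b) \<and> \<rho> = ensemble (a*b) V \<and> costs a b V < 1 / (real m + 1)"
        using V by blast
    qed
  qed
next
  have a: "0 < a" using density_op_dim_pos[OF \<rho>] by simp
  assume "separable a b \<rho>"
  then obtain V where V: "set V \<subseteq> carrier_vec (a*b)" "\<rho> = ensemble (a*b) V" "costs a b V = 0"
    by (rule separable_imp_product_ensemble)
  then have "Et a b \<rho> \<le> 0"
    using Et_le_ensemble[OF a V(1)] \<rho> by (simp add: density_op_def)
  then show "Et a b \<rho> = 0" using Et_nonneg[OF \<rho>] by simp
qed

section \<open>Invariance under local unitaries\<close>

lemma kron_mult:
  assumes "A \<in> carrier_mat n m" "C \<in> carrier_mat m p" "B \<in> carrier_mat k l" "D \<in> carrier_mat l q"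
  shows "kron A B * kron C D = kron (A * C) (B * D)"
proof (rule eq_matI)
  fix i j assume "i < dim_row (kron (A * C) (B * D))" "j < dim_col (kron (A * C) (B * D))"
  then have ij: "i < n*k" "j < p*q" using assms by auto
  have "(kron A B * kron C D) $$ (i,j) = (\<Sum>x<m*l. kron A B $$ (i,x) * kron C D $$ (x,j))"
    using ij assms by (simp add: mat_mult_index del: index_mult_mat(1))
  also have "\<dots> = (\<Sum>s<m. \<Sum>t<l. kron A B $$ (i, s*l + t) * kron C D $$ (s*l + t, j))"
    by (rule sum_product_index)
  also have "\<dots> = (\<Sum>s<m. \<Sum>t<l. (A $$ (i div k, s) * C $$ (s, j div q)) * (B $$ (i mod k, t) * D $$ (t, j mod q)))"
    using ij assms by (intro sum.cong refl) (auto simp: kron_def product_index_less)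
  also have "\<dots> = kron (A * C) (B * D) $$ (i,j)"
    using ij assms by (simp add: kron_def product_index_div_mod mat_mult_index sum_product del: index_mult_mat(1))
  finally show "(kron A B * kron C D) $$ (i,j) = kron (A * C) (B * D) $$ (i,j)" .
qed (use assms in auto)

lemma mat_adjoint_kron: "mat_adjoint (kron A B) = kron (mat_adjoint A) (mat_adjoint B)"
  by (rule eq_matI) (auto simp: kron_def product_index_div_mod)

lemma kron_one: "kron (1\<^sub>m n) (1\<^sub>m m) = 1\<^sub>m (n*m)"
proof (rule eq_matI)
  fix i j assume "i < dim_row (1\<^sub>m (n*m))" "j < dim_col (1\<^sub>m (n*m))"
  then have ij: "i < n*m" "j < n*m" by auto
  have "(i div m = j div m \<and> i mod m = j mod m) = (i = j)" by (metis div_mult_mod_eq)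
  then show "kron (1\<^sub>m n) (1\<^sub>m m) $$ (i,j) = 1\<^sub>m (n*m) $$ (i,j)"
    using ij by (auto simp: kron_def product_index_div_mod)
qed auto

lemma unitary_kron: "unitary n U \<Longrightarrow> unitary m V \<Longrightarrow> unitary (n*m) (kron U V)"
  by (simp add: unitary_def kron_carrier mat_adjoint_kron kron_mult[of _ n n _ n _ m m _ m] kron_one)

lemma unitary_adjoint:
  assumes "unitary n U"
  shows "unitary n (mat_adjoint U)"
  using unitaryD[OF assms] by (simp add: unitary_def)

lemma density_op_unitary_conj:
  assumes \<rho>: "density_op n \<rho>" and U: "unitary n U"
  shows "density_op n (U * \<rho> * mat_adjoint U)"
proof -
  note U' = unitaryD[OF U]
  have c: "\<rho> \<in> carrier_mat n n" using \<rho> by (simp add: density_op_def)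
  have "qform (U * \<rho> * mat_adjoint U) v = qform \<rho> (mat_adjoint U *\<^sub>v v)" if "v \<in> carrier_vec n" for v
    using that U'(1) c
    by (simp add: qform_def assoc_mult_mat_vec[of _ n n _ n], subst cinner_mat_adjoint[of U n n]) auto
  moreover have "mat_adjoint (U * \<rho> * mat_adjoint U) = U * \<rho> * mat_adjoint U"
    using \<rho> U'(1) c by (simp add: mat_adjoint_mult[of _ n n _ n] density_op_def assoc_mult_mat[of _ n n _ n _ n])
  moreover have "trace (U * \<rho> * mat_adjoint U) = 1"
  proof -
    have "trace (U * \<rho> * mat_adjoint U) = trace (mat_adjoint U * (U * \<rho>))"
      using U'(1) c by (intro trace_mult_comm[of _ n n]) auto
    also have "mat_adjoint U * (U * \<rho>) = (mat_adjoint U * U) * \<rho>"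
      using U'(1) c by (simp add: assoc_mult_mat[of _ n n _ n _ n])
    finally show ?thesis using \<rho> U'(3) c by (simp add: density_op_def)
  qed
  ultimately show ?thesis using \<rho> U'(1) c by (auto simp: density_op_iff_psd psd_def)
qed

text \<open>A local unitary is an operation with a single Kraus operator. The product unitary splits
  into an action on B followed by one on A, and neither increases the cost of any vector.\<close>

lemma Et_local_unitary_le:
  assumes \<rho>: "density_op (a*b) \<rho>" and UA: "unitary a UA" and UB: "unitary b UB"
  shows "Et a b (kron UA UB * \<rho> * mat_adjoint (kron UA UB)) \<le> Et a b \<rho>"
proof (rule field_le_epsilon)
  fix \<epsilon> :: real assume "0 < \<epsilon>"
  then obtain V where V: "set V \<subseteq> carrier_vec (a*b)" "\<rho> = ensemble (a*b) V" "costs a b V / rnorm a < Et a b \<rho> + \<epsilon>"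
    using Et_approx[OF \<rho>] by blast
  have a: "0 < a" using density_op_dim_pos[OF \<rho>] by simp
  note A = unitaryD[OF UA] and B = unitaryD[OF UB]
  define K where "K = kron UA UB"
  have K: "K \<in> carrier_mat (a*b) (a*b)" using A(1) B(1) by (simp add: K_def kron_carrier)
  define W where "W = map (\<lambda>v. K *\<^sub>v v) V"
  have W: "set W \<subseteq> carrier_vec (a*b)" using K by (auto simp: W_def)
  have "kraus_apply (a*b) [K] \<rho> = K * \<rho> * mat_adjoint K"
    by (rule eq_matI) (use K in \<open>auto simp: kraus_apply_def msum_def\<close>)
  then have e: "K * \<rho> * mat_adjoint K = ensemble (a*b) W"
    using kraus_apply_ensemble[OF V(1), of "[K]" "a*b"] K by (simp add: V(2) W_def)
  have cost_le: "cost a b (K *\<^sub>v v) \<le> cost a b v" if v: "v \<in> carrier_vec (a*b)" for v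
  proof -
    have one: "msum n n [1\<^sub>m n] = 1\<^sub>m n" for n by (simp add: msum_Cons)
    have "K = kron UA (1\<^sub>m b) * kron (1\<^sub>m a) UB"
      using A(1) B(1) by (simp add: K_def kron_mult[of _ a a _ a _ b b _ b])
    then have "K *\<^sub>v v = kron UA (1\<^sub>m b) *\<^sub>v (kron (1\<^sub>m a) UB *\<^sub>v v)"
      using v kron_carrier[OF A(1), of "1\<^sub>m b" b b] kron_carrier[OF _ B(1), of "1\<^sub>m a" a a]
      by (simp add: assoc_mult_mat_vec[of _ "a*b" "a*b" _ "a*b"])
    moreover have "cost a b (kron UA (1\<^sub>m b) *\<^sub>v (kron (1\<^sub>m a) UB *\<^sub>v v)) \<le> cost a b (kron (1\<^sub>m a) UB *\<^sub>v v)"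
      using cost_local_A[of "kron (1\<^sub>m a) UB *\<^sub>v v" a b "[UA]"] A B by (auto simp: one)
    moreover have "cost a b (kron (1\<^sub>m a) UB *\<^sub>v v) \<le> cost a b v"
      using cost_local_B[OF v, of "[UB]"] B by (auto simp: one)
    ultimately show ?thesis by simp
  qed
  have "trace (ensemble (a*b) W) = 1"
    using density_op_unitary_conj[OF \<rho> unitary_kron[OF UA UB]] e by (simp add: density_op_def K_def)
  from Et_le_ensemble[OF a W this] have "Et a b (ensemble (a*b) W) \<le> costs a b W / rnorm a" .
  also have "\<dots> \<le> costs a b V / rnorm a"
    unfolding costs_def W_def map_map using rnorm_nonneg[OF a] cost_le V(1)
    by (intro divide_right_mono sum_list_mono) auto
  finally show "Et a b (kron UA UB * \<rho> * mat_adjoint (kron UA UB)) \<le> Et a b \<rho> + \<epsilon>"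
    using V(3) by (simp add: e[symmetric] K_def)
qed

text \<open>The reverse inequality is the same bound for the conjugated state and the adjoint
  unitaries, which undo the conjugation.\<close>

lemma Et_local_unitary:
  assumes \<rho>: "density_op (a*b) \<rho>" and UA: "unitary a UA" and UB: "unitary b UB"
  shows "Et a b (kron UA UB * \<rho> * mat_adjoint (kron UA UB)) = Et a b \<rho>"
proof (rule antisym[OF Et_local_unitary_le[OF assms]])
  define K where "K = kron UA UB"
  have KU: "unitary (a*b) K" unfolding K_def by (rule unitary_kron[OF UA UB])
  note K = unitaryD[OF KU]
  have c: "\<rho> \<in> carrier_mat (a*b) (a*b)" using \<rho> by (simp add: density_op_def)
  have "mat_adjoint K * (K * \<rho> * mat_adjoint K) * K = (mat_adjoint K * K) * \<rho> * (mat_adjoint K * K)"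
    using K(1) c by (simp add: assoc_mult_mat[of _ "a*b" "a*b" _ "a*b" _ "a*b"])
  also have "\<dots> = \<rho>" unfolding K(3) using c by simp
  finally have "Et a b \<rho> = Et a b (mat_adjoint K * (K * \<rho> * mat_adjoint K) * mat_adjoint (mat_adjoint K))" by simp
  also have "\<dots> \<le> Et a b (K * \<rho> * mat_adjoint K)"
    using Et_local_unitary_le[OF density_op_unitary_conj[OF \<rho> KU] unitary_adjoint[OF UA] unitary_adjoint[OF UB]]
    by (simp add: mat_adjoint_kron[symmetric] K_def)
  finally show "Et a b \<rho> \<le> Et a b (kron UA UB * \<rho> * mat_adjoint (kron UA UB))" by (simp add: K_def)
qed

theorem theorem1:
  fixes dA dB :: nat
  shows
   \<comment> \<open>(E1)\<close>
   "(\<forall>\<rho>. density_op (dA*dB) \<rho> \<longrightarrow>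
        0 \<le> Et dA dB \<rho> \<and> (Et dA dB \<rho> = 0 \<longleftrightarrow> separable dA dB \<rho>)) \<and>
   \<comment> \<open>(E2)\<close>
    (\<forall>\<rho> UA UB. density_op (dA*dB) \<rho> \<longrightarrow> unitary dA UA \<longrightarrow> unitary dB UB \<longrightarrow>
        Et dA dB (kron UA UB * \<rho> * mat_adjoint (kron UA UB)) = Et dA dB \<rho>) \<and>
   \<comment> \<open>(E3): outcome j occurs with probability p_j = tr(M_j rho), leaving sigma_j = M_j rho / p_j\<close>
    (\<forall>\<rho> Ms. density_op (dA*dB) \<rho> \<longrightarrow> locc dA dB dA dB Ms \<longrightarrow>
        (\<Sum>j<length Ms. Re (trace ((Ms ! j) \<rho>)) *
            Et dA dB ((1 / trace ((Ms ! j) \<rho>)) \<cdot>\<^sub>m (Ms ! j) \<rho>)) \<le> Et dA dB \<rho>) \<and>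
   \<comment> \<open>(E4)\<close>
    (\<forall>n p \<rho>s. (\<forall>i<n. 0 \<le> p i \<and> density_op (dA*dB) (\<rho>s i)) \<longrightarrow> (\<Sum>i<n. p i) = 1 \<longrightarrow>
        Et dA dB (msum (dA*dB) (dA*dB) (map (\<lambda>i. of_real (p i) \<cdot>\<^sub>m \<rho>s i) [0..<n])) \<le> (\<Sum>i<n. p i * Et dA dB (\<rho>s i)))"
  by (intro conjI allI impI)
     (auto simp: Et_nonneg Et_eq_0_iff_separable Et_local_unitary intro!: Et_locc_monotone Et_convex)

end
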